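(* Let $\eta_t=\eta t^{-\alpha}$ for $t\ge1$ with $\eta>0$, $\alpha\in(1/2,1)$. Let $\mathfrak C_{\mathrm{sm}}=\{\mathcal M_{\mathrm{sm}}\}$, where $\mathcal M_{\mathrm{sm}}$ is the scalar stochastic oracle with mean field $g_{\mathcal M_{\mathrm{sm}}}(x)=x$ and i.i.d. standard Gaussian noise $(\epsilon_t)_{t\ge1}$ (with its natural filtration); for it $G_{\mathcal M_{\mathrm{sm}}}=S_{\mathcal M_{\mathrm{sm}}}=1$, so $Z^{\mathcal M_{\mathrm{sm}}}=W_\star^{(1)}$. Then, for any fixed $p>2$ and $q\in[1,p/2]$, the dynamics generated by this oracle satisfy conditions (A1)–(A5) of the context, and there are constants $c>0$ and $T_0<\infty$, independent of $T$, such that for every integer $T\ge T_0$, $$\mathcal D_T(\mathfrak C_{\mathrm{sm}})=d_{\mathrm P}\big(\Phi_T^{\mathcal M_{\mathrm{sm}}},W_\star^{(1)}\big)\ge c\,T^{-\frac{1-\alpha}{2}}\sqrt{\log T}.$$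
   Context: Stochastic oracle. A (scalar) stochastic oracle is a tuple $\mathcal M=(g_{\mathcal M},(\epsilon_t^{\mathcal M})_{t\ge1},(\mathcal F_t^{\mathcal M})_{t\ge0},\mathbb P_{\mathcal M})$ where $g_{\mathcal M}:\mathbb R\to\mathbb R$ is a mean field with root $x^\star=0$ and $(\epsilon_t^{\mathcal M})$ is a martingale-difference sequence adapted to $(\mathcal F_t^{\mathcal M})$ under $\mathbb P_{\mathcal M}$ (expectation $\mathbb E_{\mathcal M}$). Its dynamics are $x_1^{\mathcal M}=0$, $x_{t+1}^{\mathcal M}=x_t^{\mathcal M}-\eta_tg_{\mathcal M}(x_t^{\mathcal M})+\eta_t\epsilon_t^{\mathcal M}$. The path $\Phi_T^{\mathcal M}:[0,1]\to\mathbb R$ has $\Phi_T^{\mathcal M}(n/T)=T^{-1/2}\sum_{t=1}^nx_{t+1}^{\mathcal M}$, $0\le n\le T$, and is linearly interpolated in between. Conditions (with $x^\star=0$). (A1) For some $G_{\mathcal M}>0$, $\delta_g>0$, $C_{\mathrm{sm}},C_{\mathrm{bd}}<\infty$: $|g_{\mathcal M}(x)-G_{\mathcal M}x|\le C_{\mathrm{sm}}x^2$ for $|x|\le\delta_g$ and $\sup_{x\in\mathbb R}|g_{\mathcal M}(x)-G_{\mathcal M}x|\le C_{\mathrm{bd}}$. (A2) The step sizes are $\eta_t=\eta t^{-\alpha}$, $\eta>0$, $\alpha\in(1/2,1)$. (A3) For a deterministic $M_p<\infty$, a.s. for all $t\ge1$: $\mathbb E_{\mathcal M}[\epsilon_t^{\mathcal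 M}\mid\mathcal F_{t-1}^{\mathcal M}]=0$ and $\mathbb E_{\mathcal M}[|\epsilon_t^{\mathcal M}|^p\mid\mathcal F_{t-1}^{\mathcal M}]\le M_p$. (A4) For some $S_{\mathcal M}\ge0$ (the limiting variance), $C_S<\infty$ and exponent $\gamma>0$, for every integer $m\ge2$: $\mathbb E_{\mathcal M}\big[\max_{0\le n\le m}\big|\frac1m\sum_{t=1}^n\mathbb E_{\mathcal M}[(\epsilon_t^{\mathcal M})^2\mid\mathcal F_{t-1}^{\mathcal M}]-\frac nmS_{\mathcal M}\big|\big]\le C_Sm^{-3\gamma}$. (A5) For some $C_\Delta<\infty$: $\mathbb E_{\mathcal M}[|x_t^{\mathcal M}|^{2q}]\le C_\Delta\eta_t^q$ for every $t\ge1$. Target and worst-case error. $Z^{\mathcal M}=G_{\mathcal M}^{-1}S_{\mathcal M}^{1/2}W_\star^{(1)}$ with $W_\star^{(1)}$ a standard one-dimensional Brownian motion on $[0,1]$, and $\mathcal D_T(\mathfrak C)=\sup_{\mathcal M\in\mathfrak C}d_{\mathrm P}(\Phi_T^{\mathcal M},Z^{\mathcal M})$. Metrics. With $\Lambda$ the set of strictly increasing continuous bijections of $[0,1]$, for càdlàg $f,h\in D([0,1],\mathbb R)$: $d_{\mathrm S}(f,h)=\inf_{\lambda\in\Lambda}\{\sup_{0\le s<t\le1}|\log\frac{\lambda(t)-\lambda(s)}{t-s}|\vee\sup_{r}|f(\lambda(r))-h(r)|\}$. $d_{\mathrm P}(\mu,\nu)$ is the infimum of $\delta>0$ such that $\mu(\Gamma)\le\nu(\Gamma^\delta)+\delta$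 and $\nu(\Gamma)\le\mu(\Gamma^\delta)+\delta$ for every Borel $\Gamma\subset(D([0,1],\mathbb R),d_{\mathrm S})$, where $\Gamma^\delta=\{h:\inf_{f\in\Gamma}d_{\mathrm S}(f,h)<\delta\}$; for random elements it is applied to their laws. *)

theory Defs
  imports "HOL-Probability.Probability"
begin

section \<open>The Skorokhod space on the unit interval\<close>

text \<open>Paths are functions on \<^term>\<open>{0..1::real}\<close>, made total by the convention of \<^const>\<open>extensional\<close>, so
  that two paths are equal as soon as they agree on the unit interval.\<close>

definition skorokhod_space :: "(real \<Rightarrow> real) set" where
  "skorokhod_space = {f \<in> extensional {0..1}.
     (\<forall>t. 0 \<le> t \<and> t < 1 \<longrightarrow> (f \<longlongrightarrow> f t) (at_right t)) \<and>
     (\<forall>t. 0 < t \<and> t \<le> 1 \<longrightarrow> (\<exists>l. (f \<longlongrightarrow> l) (at_left t)))}"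

definition time_changes :: "(real \<Rightarrow> real) set" where
  "time_changes = {l. strict_mono_on {0..1} l \<and> continuous_on {0..1} l \<and> bij_betw l {0..1} {0..1}}"

text \<open>The suprema are taken in \<^typ>\<open>ereal\<close>, because the log-slopes of a time change can be unbounded;
  the distance of two elements of \<^const>\<open>skorokhod_space\<close> is finite.\<close>

definition skorokhod_dist :: "(real \<Rightarrow> real) \<Rightarrow> (real \<Rightarrow> real) \<Rightarrow> ereal" where
  "skorokhod_dist f h = (INF l\<in>time_changes.
     max (SUP (s, t)\<in>{(s, t). 0 \<le> s \<and> s < t \<and> t \<le> 1}. ereal \<bar>ln ((l t - l s) / (t - s))\<bar>)
         (SUP r\<in>{0..1}. ereal \<bar>f (l r) - h r\<bar>))"

definition skorokhod_borel :: "(real \<Rightarrow> real) measure" where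
  "skorokhod_borel = sigma skorokhod_space
     {U. U \<subseteq> skorokhod_space \<and>
         (\<forall>f\<in>U. \<exists>r>0. \<forall>h\<in>skorokhod_space. skorokhod_dist f h < ereal r \<longrightarrow> h \<in> U)}"


section \<open>The Prokhorov distance\<close>

definition skorokhod_nbhd :: "(real \<Rightarrow> real) set \<Rightarrow> real \<Rightarrow> (real \<Rightarrow> real) set" where
  "skorokhod_nbhd A \<delta> = {h \<in> skorokhod_space. (INF f\<in>A. skorokhod_dist f h) < ereal \<delta>}"

definition prokhorov_dist :: "(real \<Rightarrow> real) measure \<Rightarrow> (real \<Rightarrow> real) measure \<Rightarrow> real" where
  "prokhorov_dist \<mu> \<nu> = Inf {\<delta>. 0 < \<delta> \<and>
     (\<forall>A\<in>sets skorokhod_borel.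
        measure \<mu> A \<le> measure \<nu> (skorokhod_nbhd A \<delta>) + \<delta> \<and>
        measure \<nu> A \<le> measure \<mu> (skorokhod_nbhd A \<delta>) + \<delta>)}"

abbreviation path_law :: "'a measure \<Rightarrow> ('a \<Rightarrow> real \<Rightarrow> real) \<Rightarrow> (real \<Rightarrow> real) measure" where
  "path_law P X \<equiv> distr P skorokhod_borel X"


section \<open>Standard Brownian motion on the unit interval\<close>

definition brownian_motion :: "'b measure \<Rightarrow> (real \<Rightarrow> 'b \<Rightarrow> real) \<Rightarrow> bool" where
  "brownian_motion N W \<longleftrightarrow>
     prob_space N \<and>
     (\<forall>t\<in>{0..1}. W t \<in> borel_measurable N) \<and>
     (AE \<omega> in N. W 0 \<omega> = 0) \<and>
     (\<forall>s t. 0 \<le> s \<and> s < t \<and> t \<le> 1 \<longrightarrow>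
        distributed N lborel (\<lambda>\<omega>. W t \<omega> - W s \<omega>) (normal_density 0 (sqrt (t - s)))) \<and>
     (\<forall>n (\<tau> :: nat \<Rightarrow> real). (\<forall>i\<le>n. \<tau> i \<in> {0..1}) \<and> (\<forall>i<n. \<tau> i < \<tau> (Suc i)) \<longrightarrow>
        prob_space.indep_vars N (\<lambda>_. borel) (\<lambda>i \<omega>. W (\<tau> (Suc i)) \<omega> - W (\<tau> i) \<omega>) {..<n}) \<and>
     (\<forall>\<omega>\<in>space N. continuous_on {0..1} (\<lambda>t. W t \<omega>))"


section \<open>Stochastic oracles\<close>

text \<open>The noise is indexed from 1; the value \<open>noise M 0\<close> is never used.\<close>

record 'a stoch_oracle =
  mean_field :: "real \<Rightarrow> real"
  noise :: "nat \<Rightarrow> 'a \<Rightarrow> real"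
  filtr :: "nat \<Rightarrow> 'a measure"
  pspace :: "'a measure"

definition is_stoch_oracle :: "'a stoch_oracle \<Rightarrow> bool" where
  "is_stoch_oracle M \<longleftrightarrow>
     prob_space (pspace M) \<and>
     filtration (space (pspace M)) (filtr M) \<and>
     (\<forall>t. subalgebra (pspace M) (filtr M t)) \<and>
     mean_field M \<in> borel_measurable borel \<and>
     mean_field M 0 = 0 \<and>
     (\<forall>t\<ge>1. noise M t \<in> borel_measurable (filtr M t)) \<and>
     (\<forall>t\<ge>1. integrable (pspace M) (noise M t)) \<and>
     (\<forall>t\<ge>1. AE \<omega> in pspace M. real_cond_exp (pspace M) (filtr M (t - 1)) (noise M t) \<omega> = 0)"

text \<open>The recursion starts at index 1; index 0 is a dummy.\<close>

fun iterate :: "(nat \<Rightarrow> real) \<Rightarrow> 'a stoch_oracle \<Rightarrow> nat \<Rightarrow> 'a \<Rightarrow> real" where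
  "iterate \<eta> M 0 \<omega> = 0"
| "iterate \<eta> M (Suc 0) \<omega> = 0"
| "iterate \<eta> M (Suc (Suc n)) \<omega> =
     iterate \<eta> M (Suc n) \<omega>
     - \<eta> (Suc n) * mean_field M (iterate \<eta> M (Suc n) \<omega>)
     + \<eta> (Suc n) * noise M (Suc n) \<omega>"

text \<open>With \<open>n = \<lfloor>u T\<rfloor>\<close>, the slope of the interpolation between \<open>n / T\<close> and \<open>(n + 1) / T\<close> is governed
  by the next summand \<open>x\<^bsub>n+2\<^esub>\<close>.\<close>

definition avg_path :: "(nat \<Rightarrow> real) \<Rightarrow> 'a stoch_oracle \<Rightarrow> nat \<Rightarrow> 'a \<Rightarrow> real \<Rightarrow> real" where
  "avg_path \<eta> M T \<omega> = (\<lambda>u\<in>{0..1}.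
     let n = nat \<lfloor>u * real T\<rfloor> in
     ((\<Sum>t=1..n. iterate \<eta> M (t + 1) \<omega>) + (u * real T - real n) * iterate \<eta> M (n + 2) \<omega>)
       / sqrt (real T))"


section \<open>The conditions\<close>

definition cond_A1 :: "'a stoch_oracle \<Rightarrow> real \<Rightarrow> bool" where
  "cond_A1 M G \<longleftrightarrow> 0 < G \<and>
     (\<exists>\<delta>>0. \<exists>Csm Cbd.
        (\<forall>x. \<bar>x\<bar> \<le> \<delta> \<longrightarrow> \<bar>mean_field M x - G * x\<bar> \<le> Csm * x\<^sup>2) \<and>
        (\<forall>x. \<bar>mean_field M x - G * x\<bar> \<le> Cbd))"

definition cond_A2 :: "(nat \<Rightarrow> real) \<Rightarrow> real \<Rightarrow> real \<Rightarrow> bool" where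
  "cond_A2 \<eta> \<eta>0 \<alpha> \<longleftrightarrow> 0 < \<eta>0 \<and> 1 / 2 < \<alpha> \<and> \<alpha> < 1 \<and> (\<forall>t\<ge>1. \<eta> t = \<eta>0 * real t powr (- \<alpha>))"

text \<open>Expectations of nonnegative quantities that are to be bounded are taken in \<^typ>\<open>ennreal\<close>, so
  that the bound includes finiteness.\<close>

definition cond_A3 :: "'a stoch_oracle \<Rightarrow> real \<Rightarrow> bool" where
  "cond_A3 M p \<longleftrightarrow> (\<exists>Mp::real. AE \<omega> in pspace M. \<forall>t\<ge>1.
     real_cond_exp (pspace M) (filtr M (t - 1)) (noise M t) \<omega> = 0 \<and>
     nn_cond_exp (pspace M) (filtr M (t - 1)) (\<lambda>\<omega>'. ennreal (\<bar>noise M t \<omega>'\<bar> powr p)) \<omega> \<le> ennreal Mp)"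

definition cond_A4 :: "'a stoch_oracle \<Rightarrow> real \<Rightarrow> bool" where
  "cond_A4 M S \<longleftrightarrow> 0 \<le> S \<and>
     (\<forall>t\<ge>1. integrable (pspace M) (\<lambda>\<omega>. (noise M t \<omega>)\<^sup>2)) \<and>
     (\<exists>CS. \<exists>\<gamma>>0. \<forall>m\<ge>2.
        (\<integral>\<^sup>+ \<omega>. ennreal (MAX n\<in>{0..m}.
             \<bar>1 / real m * (\<Sum>t=1..n. real_cond_exp (pspace M) (filtr M (t - 1)) (\<lambda>\<omega>'. (noise M t \<omega>')\<^sup>2) \<omega>)
               - real n / real m * S\<bar>) \<partial>pspace M)
          \<le> ennreal (CS * real m powr (- 3 * \<gamma>)))"

definition cond_A5 :: "(nat \<Rightarrow> real) \<Rightarrow> 'a stoch_oracle \<Rightarrow> real \<Rightarrow> bool" where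
  "cond_A5 \<eta> M q \<longleftrightarrow> (\<exists>C. \<forall>t\<ge>1.
     (\<integral>\<^sup>+ \<omega>. ennreal (\<bar>iterate \<eta> M t \<omega>\<bar> powr (2 * q)) \<partial>pspace M) \<le> ennreal (C * \<eta> t powr q))"


section \<open>Target process and worst-case error\<close>

definition target_path :: "real \<Rightarrow> real \<Rightarrow> (real \<Rightarrow> 'b \<Rightarrow> real) \<Rightarrow> 'b \<Rightarrow> real \<Rightarrow> real" where
  "target_path G S W \<omega> = (\<lambda>t\<in>{0..1}. inverse G * sqrt S * W t \<omega>)"

text \<open>\<open>G\<close> and \<open>S\<close> assign to every member of the class its linearisation and its limiting variance,
  that is, the constants of \<^const>\<open>cond_A1\<close> and \<^const>\<open>cond_A4\<close>. The supremum is meant for nonempty classes;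
  it is over numbers in the unit interval.\<close>

definition worst_case_error ::
  "'b measure \<Rightarrow> (real \<Rightarrow> 'b \<Rightarrow> real) \<Rightarrow> (nat \<Rightarrow> real) \<Rightarrow> ('a stoch_oracle \<Rightarrow> real) \<Rightarrow>
   ('a stoch_oracle \<Rightarrow> real) \<Rightarrow> nat \<Rightarrow> 'a stoch_oracle set \<Rightarrow> real" where
  "worst_case_error N W \<eta> G S T C =
     (SUP M\<in>C. prokhorov_dist (path_law (pspace M) (avg_path \<eta> M T))
                              (path_law N (target_path (G M) (S M) W)))"


section \<open>The linear oracle with Gaussian noise\<close>

definition natural_filtration :: "'a measure \<Rightarrow> (nat \<Rightarrow> 'a \<Rightarrow> real) \<Rightarrow> nat \<Rightarrow> 'a measure" where
  "natural_filtration P \<epsilon> t =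
     sigma (space P) {\<epsilon> s -` B \<inter> space P | s B. s \<in> {1..t} \<and> B \<in> sets borel}"

definition iid_std_normal :: "'a measure \<Rightarrow> (nat \<Rightarrow> 'a \<Rightarrow> real) \<Rightarrow> bool" where
  "iid_std_normal P \<epsilon> \<longleftrightarrow>
     prob_space P \<and>
     prob_space.indep_vars P (\<lambda>_. borel) \<epsilon> {1..} \<and>
     (\<forall>t\<ge>1. distributed P lborel (\<epsilon> t) std_normal_density)"

definition linear_oracle :: "'a measure \<Rightarrow> (nat \<Rightarrow> 'a \<Rightarrow> real) \<Rightarrow> 'a stoch_oracle" where
  "linear_oracle P \<epsilon> =
     \<lparr>mean_field = (\<lambda>x. x), noise = \<epsilon>, filtr = natural_filtration P \<epsilon>, pspace = P\<rparr>"

end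

theory Submission
  imports Defs "HOL-Real_Asymp.Real_Asymp"
begin

text \<open>The averaged path is smoother than Brownian motion at small scales, and this is what separates the
  two laws. Its slope is \<open>sqrt T\<close> times an iterate, and the iterates of the linear recursion are Gaussian
  with variance of the order of the step size, \<open>T powr (- \<alpha>)\<close> in the second half of the run. All of
  them stay below a multiple of \<open>T powr (- \<alpha> / 2) * sqrt (ln T)\<close> with high probability
  (\<open>iterate_max_bound\<close>). So over a time \<open>h = \<kappa> T powr (\<alpha> - 1)\<close> the path moves by at most a constant
  times \<open>\<kappa> R\<close>, where \<open>R = T powr (- (1 - \<alpha>) / 2) * sqrt (ln T)\<close> (\<open>avg_path_modulus\<close>). Brownian motion
  has of the order of \<open>1 / h\<close> independent increments of standard deviation \<open>sqrt h\<close> over such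
  times, and the largest of them exceeds a constant times \<open>sqrt \<kappa> R\<close> with high probability
  (\<open>brownian_grid_increments_small\<close>). For small \<open>\<kappa>\<close> the second bound dominates the first.

  For the Prokhorov distance this is tested on the set of paths whose increments over times less than
  \<open>3 h\<close>, after time \<open>1 / 2\<close>, are small. A time change that is admissible in the Skorokhod distance may move
  times by far more than \<open>h\<close>, so the values of two close paths at fixed grid points cannot be compared.
  But it changes the length of short intervals only by a factor close to 1; a modulus of continuity is
  therefore stable under small Skorokhod perturbations (\<open>modulus_set_nbhd\<close>) and defines a closed
  set (\<open>modulus_set_measurable\<close>).

  The conditions on the oracle follow from the independence of the noise, which makes conditional
  expectations constant, and from a bound on the moment generating function of the iterates, which
  are weighted sums of the noise (\<open>iterate_subgaussian\<close>).\<close>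

section \<open>Moduli of continuity in the Skorokhod space\<close>

lemma
  assumes "l \<in> time_changes"
  shows time_change_0: "l 0 = 0" and time_change_range: "\<And>u. u \<in> {0..1} \<Longrightarrow> l u \<in> {0..1}"
proof -
  have m: "strict_mono_on {0..1} l" and b: "bij_betw l {0..1} {0..1}"
    using assms by (auto simp: time_changes_def)
  show r: "l u \<in> {0..1}" if "u \<in> {0..1}" for u
    using b that by (metis bij_betwE)
  obtain u where u: "u \<in> {0..1}" "l u = 0"
    using b by (metis atLeastAtMost_iff bij_betw_iff_bijections order_refl zero_le_one)
  show "l 0 = 0"
    using u r[of 0] strict_mono_onD[OF m, of 0 u] by (cases "u = 0") auto
qed

text \<open>A bound on the log-slopes of a time change is the two-sided Lipschitz bound with constants
  \<open>exp (- r)\<close> and \<open>exp r\<close>. In this form it transports conditions on \<open>\<bar>t - s\<bar>\<close> and, since time changes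
  fix 0, lower bounds on times, from one path to a Skorokhod-close one.\<close>

lemma skorokhod_dist_lessE:
  assumes "skorokhod_dist f h < ereal r"
  obtains l where "l \<in> time_changes"
    and "\<And>s t. 0 \<le> s \<Longrightarrow> s \<le> t \<Longrightarrow> t \<le> 1 \<Longrightarrow> exp (- r) * (t - s) \<le> l t - l s"
    and "\<And>s t. 0 \<le> s \<Longrightarrow> s \<le> t \<Longrightarrow> t \<le> 1 \<Longrightarrow> l t - l s \<le> exp r * (t - s)"
    and "\<And>u. u \<in> {0..1} \<Longrightarrow> \<bar>f (l u) - h u\<bar> < r"
proof -
  obtain l where l: "l \<in> time_changes"
    and less: "max (SUP (s, t)\<in>{(s, t). 0 \<le> s \<and> s < t \<and> t \<le> 1}. ereal \<bar>ln ((l t - l s) / (t - s))\<bar>)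
         (SUP u\<in>{0..1}. ereal \<bar>f (l u) - h u\<bar>) < ereal r"
    using assms unfolding skorokhod_dist_def INF_less_iff by blast
  have dist: "\<bar>f (l u) - h u\<bar> < r" if "u \<in> {0..1}" for u
  proof -
    have "ereal \<bar>f (l u) - h u\<bar> \<le> (SUP u\<in>{0..1}. ereal \<bar>f (l u) - h u\<bar>)"
      using that by (rule SUP_upper)
    then have "ereal \<bar>f (l u) - h u\<bar> < ereal r"
      using less by (meson le_less_trans max_less_iff_conj)
    then show ?thesis by simp
  qed
  have m: "strict_mono_on {0..1} l" using l by (auto simp: time_changes_def)
  have slope: "exp (- r) * (t - s) \<le> l t - l s \<and> l t - l s \<le> exp r * (t - s)"
    if st: "0 \<le> s" "s < t" "t \<le> 1" for s t
  proof -
    have "ereal \<bar>ln ((l t - l s) / (t - s))\<bar>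
        \<le> (SUP (s, t)\<in>{(s, t). 0 \<le> s \<and> s < t \<and> t \<le> 1}. ereal \<bar>ln ((l t - l s) / (t - s))\<bar>)"
      using st by (intro SUP_upper2[of "(s, t)"]) auto
    then have "ereal \<bar>ln ((l t - l s) / (t - s))\<bar> < ereal r"
      using less by (meson le_less_trans max_less_iff_conj)
    then have b: "\<bar>ln ((l t - l s) / (t - s))\<bar> < r" by simp
    have pos: "0 < (l t - l s) / (t - s)"
      using strict_mono_onD[OF m, of s t] st by simp
    have "exp (- r) \<le> (l t - l s) / (t - s)"
      using pos b by (subst ln_ge_iff[symmetric]) auto
    moreover have "(l t - l s) / (t - s) \<le> exp r"
      using pos b by (metis abs_less_iff exp_le_cancel_iff exp_ln less_imp_le)
    ultimately show ?thesis using st by (simp add: field_simps)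
  qed
  show ?thesis
  proof (rule that[OF l _ _ dist])
    fix s t :: real assume "0 \<le> s" "s \<le> t" "t \<le> 1"
    then show "exp (- r) * (t - s) \<le> l t - l s" "l t - l s \<le> exp r * (t - s)"
      using slope[of s t] by (cases "s = t"; simp)+
  qed
qed

lemma skorokhod_dist_le_uniform:
  assumes "0 \<le> r" and "\<And>u. u \<in> {0..1} \<Longrightarrow> \<bar>f u - h u\<bar> \<le> r"
  shows "skorokhod_dist f h \<le> ereal r"
proof -
  have id: "(\<lambda>x. x) \<in> time_changes"
    by (auto simp: time_changes_def strict_mono_on_def bij_betw_def)
  define g where "g l = max (SUP (s, t)\<in>{(s, t). 0 \<le> s \<and> s < t \<and> t \<le> 1}. ereal \<bar>ln ((l t - l s) / (t - s))\<bar>)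
         (SUP u\<in>{0..1}. ereal \<bar>f (l u) - h u\<bar>)" for l
  have "skorokhod_dist f h = (INF l\<in>time_changes. g l)"
    by (simp add: skorokhod_dist_def g_def)
  also have "\<dots> \<le> g (\<lambda>x. x)"
    by (rule INF_lower[OF id])
  also have "\<dots> \<le> ereal r"
    using assms by (auto simp: g_def intro!: SUP_least)
  finally show ?thesis .
qed

lemma continuous_path_in_skorokhod_space:
  assumes "f \<in> extensional {0..1}" and "continuous_on {0..1} f"
  shows "f \<in> skorokhod_space"
  unfolding skorokhod_space_def
proof (intro CollectI conjI allI impI)
  fix t :: real assume t: "0 \<le> t \<and> t < 1"
  have "(f \<longlongrightarrow> f t) (at t within {0..1})"
    using assms(2) t by (simp add: continuous_on_def)
  then have "(f \<longlongrightarrow> f t) (at t within {t..1})"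
    by (rule tendsto_within_subset) (use t in auto)
  then show "(f \<longlongrightarrow> f t) (at_right t)"
    using t by (simp add: at_within_Icc_at_right)
next
  fix t :: real assume t: "0 < t \<and> t \<le> 1"
  have "(f \<longlongrightarrow> f t) (at t within {0..1})"
    using assms(2) t by (simp add: continuous_on_def)
  then have "(f \<longlongrightarrow> f t) (at t within {0..t})"
    by (rule tendsto_within_subset) (use t in auto)
  then show "\<exists>l. (f \<longlongrightarrow> l) (at_left t)"
    using t by (auto simp: at_within_Icc_at_left)
qed (use assms in auto)

text \<open>The early part of the averaged path is excluded because the iterates are large there. The two
  constraints on \<open>s\<close> and \<open>t\<close> that a time change can violate, the lower bound on \<open>s\<close> and the bound on
  \<open>t - s\<close>, are strict; this makes the set closed.\<close>

definition modulus_set :: "real \<Rightarrow> real \<Rightarrow> (real \<Rightarrow> real) set" where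
  "modulus_set d a = {f \<in> skorokhod_space.
     \<forall>s t. 1 / 2 < s \<and> s \<le> t \<and> t \<le> 1 \<and> t - s < d \<longrightarrow> \<bar>f t - f s\<bar> \<le> a}"

lemma skorokhod_space_in_sets: "skorokhod_space \<in> sets skorokhod_borel"
  and sets_skorokhod_borel_open:
  "U \<subseteq> skorokhod_space \<Longrightarrow>
     (\<And>f. f \<in> U \<Longrightarrow> \<exists>r>0. \<forall>h\<in>skorokhod_space. skorokhod_dist f h < ereal r \<longrightarrow> h \<in> U) \<Longrightarrow>
     U \<in> sets skorokhod_borel"
proof -
  let ?G = "{U. U \<subseteq> skorokhod_space \<and>
         (\<forall>f\<in>U. \<exists>r>0. \<forall>h\<in>skorokhod_space. skorokhod_dist f h < ereal r \<longrightarrow> h \<in> U)}"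
  have G: "?G \<subseteq> Pow skorokhod_space" by auto
  have sets: "sets skorokhod_borel = sigma_sets skorokhod_space ?G"
    unfolding skorokhod_borel_def by (rule sets_measure_of[OF G])
  show "skorokhod_space \<in> sets skorokhod_borel"
    unfolding sets by (rule sigma_sets_top)
  show "U \<in> sets skorokhod_borel" if "U \<subseteq> skorokhod_space"
     "\<And>f. f \<in> U \<Longrightarrow> \<exists>r>0. \<forall>h\<in>skorokhod_space. skorokhod_dist f h < ereal r \<longrightarrow> h \<in> U"
    unfolding sets by (rule sigma_sets.Basic) (use that in blast)
qed

text \<open>The complement is open: a pair of times that violates the modulus bound for \<open>f\<close> is carried, by the
  inverse of a time change close to the identity, to a pair that violates it for a nearby path.\<close>

lemma modulus_set_measurable: "modulus_set d a \<in> sets skorokhod_borel"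
proof -
  define U where "U = skorokhod_space - modulus_set d a"
  have "U \<in> sets skorokhod_borel"
  proof (rule sets_skorokhod_borel_open)
    show "U \<subseteq> skorokhod_space" by (auto simp: U_def)
    fix f assume "f \<in> U"
    then obtain s t where st: "1 / 2 < s" "s \<le> t" "t \<le> 1" "t - s < d" and a: "a < \<bar>f t - f s\<bar>"
      by (auto simp: U_def modulus_set_def not_le)
    \<comment> \<open>The radius keeps the transported times after \<open>1 / 2\<close> and closer than \<open>d\<close>, and the two errors
      of size \<open>r\<close> below the excess of the increment over \<open>a\<close>.\<close>
    have lim: "((\<lambda>r. exp (- r) * s) \<longlongrightarrow> s) (at_right 0)"
      "((\<lambda>r. exp r * (t - s)) \<longlongrightarrow> t - s) (at_right (0::real))"
      by (auto intro!: tendsto_eq_intros)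
    have "\<forall>\<^sub>F r in at_right (0::real). 0 < r \<and> 1 / 2 < exp (- r) * s \<and> exp r * (t - s) < d
        \<and> r < (\<bar>f t - f s\<bar> - a) / 2"
      using st a
      by (intro eventually_conj eventually_at_right_less
        order_tendstoD(1)[OF lim(1)] order_tendstoD(2)[OF lim(2)] order_tendstoD(2)[OF tendsto_ident_at]) auto
    then obtain r where r: "0 < r" "1 / 2 < exp (- r) * s" "exp r * (t - s) < d"
        "r < (\<bar>f t - f s\<bar> - a) / 2"
      using eventually_happens trivial_limit_at_right_real by blast
    show "\<exists>r>0. \<forall>h\<in>skorokhod_space. skorokhod_dist f h < ereal r \<longrightarrow> h \<in> U"
    proof (intro exI[of _ r] conjI ballI impI r(1))
      fix h assume h: "h \<in> skorokhod_space" and "skorokhod_dist f h < ereal r"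
      from this(2) obtain l where l: "l \<in> time_changes"
        and lo: "\<And>s t. 0 \<le> s \<Longrightarrow> s \<le> t \<Longrightarrow> t \<le> 1 \<Longrightarrow> exp (- r) * (t - s) \<le> l t - l s"
        and up: "\<And>s t. 0 \<le> s \<Longrightarrow> s \<le> t \<Longrightarrow> t \<le> 1 \<Longrightarrow> l t - l s \<le> exp r * (t - s)"
        and dist: "\<And>u. u \<in> {0..1} \<Longrightarrow> \<bar>f (l u) - h u\<bar> < r"
        by (rule skorokhod_dist_lessE) blast
      have bij: "bij_betw l {0..1} {0..1}" and m: "strict_mono_on {0..1} l"
        using l by (auto simp: time_changes_def)
      have "s \<in> l ` {0..1}" using bij st by (auto simp: bij_betw_def)
      then obtain s' where s': "s' \<in> {0..1}" "l s' = s" by force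
      have "t \<in> l ` {0..1}" using bij st by (auto simp: bij_betw_def)
      then obtain t' where t': "t' \<in> {0..1}" "l t' = t" by force
      have le: "s' \<le> t'"
        using strict_mono_onD[OF m, of t' s'] s' t' st by (cases "s' \<le> t'") auto
      have "s \<le> exp r * s'"
        using up[of 0 s'] s' time_change_0[OF l] by simp
      then have "exp (- r) * s \<le> s'"
        by (simp add: exp_minus field_simps)
      moreover have "t' - s' \<le> exp r * (t - s)"
        using lo[of s' t'] s' t' le by (simp add: exp_minus field_simps)
      moreover have "a < \<bar>h t' - h s'\<bar>"
        using dist[OF s'(1)] dist[OF t'(1)] s' t' r(4) by simp
      ultimately have "1 / 2 < s'" "t' - s' < d" "a < \<bar>h t' - h s'\<bar>"
        using r by linarith+
      moreover have "\<bar>h t' - h s'\<bar> \<le> a" if "h \<in> modulus_set d a" "1 / 2 < s'" "t' - s' < d"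
        using that le t'(1) unfolding modulus_set_def by simp
      ultimately have "h \<notin> modulus_set d a" by linarith
      then show "h \<in> U" using h by (simp add: U_def)
    qed
  qed
  moreover have "modulus_set d a = skorokhod_space - U"
    by (auto simp: U_def modulus_set_def)
  ultimately show ?thesis
    using skorokhod_space_in_sets by auto
qed

text \<open>Membership in a neighbourhood of a modulus set controls every small increment of a path, although
  the time change may move times by much more than the length of the increment: it at most doubles
  that length, and it takes times after \<open>3 / 4\<close> to times after \<open>1 / 2\<close>.\<close>

lemma modulus_set_nbhd:
  assumes h: "h \<in> skorokhod_nbhd (modulus_set d a) r"
    and r: "0 < r" "r \<le> 1 / 3" and st: "3 / 4 \<le> s" "s \<le> t" "t \<le> 1" "2 * (t - s) < d"
  shows "\<bar>h t - h s\<bar> \<le> a + 2 * r"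
proof -
  obtain f where f: "f \<in> modulus_set d a" and "skorokhod_dist f h < ereal r"
    using h by (auto simp: skorokhod_nbhd_def INF_less_iff)
  from this(2) obtain l where l: "l \<in> time_changes"
    and lo: "\<And>s t. 0 \<le> s \<Longrightarrow> s \<le> t \<Longrightarrow> t \<le> 1 \<Longrightarrow> exp (- r) * (t - s) \<le> l t - l s"
    and up: "\<And>s t. 0 \<le> s \<Longrightarrow> s \<le> t \<Longrightarrow> t \<le> 1 \<Longrightarrow> l t - l s \<le> exp r * (t - s)"
    and dist: "\<And>u. u \<in> {0..1} \<Longrightarrow> \<bar>f (l u) - h u\<bar> < r"
    by (rule skorokhod_dist_lessE) blast
  have "1 - r \<le> exp (- r)" using exp_ge_add_one_self[of "- r"] by simp
  then have "2 / 3 < exp (- r)"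
    using exp_minus_greater[of r] r by linarith
  then have exps: "2 / 3 < exp (- r)" "exp r \<le> 2"
    by (auto simp: exp_minus field_simps)
  have "1 / 2 < exp (- r) * s"
    using mult_strict_mono[OF exps(1), of "3/4" s] mult_less_le_imp_less[OF exps(1) st(1)] by simp
  then have "1 / 2 < l s"
    using lo[of 0 s] st time_change_0[OF l] by simp
  moreover have "0 \<le> exp (- r) * (t - s)" using st by simp
  then have "l s \<le> l t"
    using lo[of s t] st by linarith
  moreover have "l t \<le> 1"
    using time_change_range[OF l, of t] st by simp
  moreover have "exp r * (t - s) \<le> 2 * (t - s)"
    using exps st by (intro mult_right_mono) auto
  then have "l t - l s < d"
    using up[of s t] st by linarith
  ultimately have "\<bar>f (l t) - f (l s)\<bar> \<le> a"
    using f by (auto simp: modulus_set_def)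
  then show ?thesis
    using dist[of s] dist[of t] st by (simp add: abs_le_iff abs_less_iff)
qed

section \<open>Laws of paths and the Prokhorov distance\<close>

text \<open>This bound holds for every map, measurable or not, because \<^const>\<open>distr\<close> assigns to each set either the
  mass of its preimage or 0. It bounds the law of the Brownian path through events of the underlying
  probability space.\<close>

lemma measure_distr_le:
  fixes f :: "'a \<Rightarrow> 'c"
  assumes "prob_space P" and S: "{\<omega> \<in> space P. Q \<omega>} \<in> sets P"
    and B: "\<And>\<omega>. \<omega> \<in> space P \<Longrightarrow> f \<omega> \<in> B \<Longrightarrow> Q \<omega>"
  shows "measure (distr P K f) B \<le> measure P {\<omega> \<in> space P. Q \<omega>}"
proof -
  interpret prob_space P by fact
  have "emeasure (distr P K f) B \<le> emeasure P (f -` B \<inter> space P)"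
    unfolding distr_def
    by (subst emeasure_measure_of_conv) auto
  also have "\<dots> \<le> emeasure P {\<omega> \<in> space P. Q \<omega>}"
    using B by (intro emeasure_mono S) auto
  finally show ?thesis
    unfolding measure_def by (intro enn2real_mono) (auto simp: emeasure_eq_measure)
qed

lemma measure_distr_le_1:
  assumes "prob_space P"
  shows "measure (distr P K f) B \<le> 1"
  using measure_distr_le[OF assms, of "\<lambda>_. True" f B K] prob_space.prob_space[OF assms] by simp

text \<open>A lower bound on an infimum in \<^typ>\<open>real\<close> needs the set to be nonempty; it contains 1, as all masses
  are at most 1.\<close>

lemma prokhorov_dist_ge:
  fixes X :: "'a \<Rightarrow> real \<Rightarrow> real" and Y :: "'b \<Rightarrow> real \<Rightarrow> real"
  assumes "prob_space P" "prob_space N"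
    and far: "\<And>\<delta>. 0 < \<delta> \<Longrightarrow> \<delta> < r \<Longrightarrow>
      \<exists>A\<in>sets skorokhod_borel. measure (path_law N Y) (skorokhod_nbhd A \<delta>) + \<delta> < measure (path_law P X) A"
  shows "r \<le> prokhorov_dist (path_law P X) (path_law N Y)"
  unfolding prokhorov_dist_def
proof (rule cInf_greatest)
  note le1 = measure_distr_le_1[OF assms(1), of skorokhod_borel X] measure_distr_le_1[OF assms(2), of skorokhod_borel Y]
  have "measure (path_law P X) A \<le> measure (path_law N Y) (skorokhod_nbhd A 1) + 1"
    "measure (path_law N Y) A \<le> measure (path_law P X) (skorokhod_nbhd A 1) + 1" for A
    using le1(1)[of A] le1(2)[of A] measure_nonneg[of "path_law N Y" "skorokhod_nbhd A 1"]
      measure_nonneg[of "path_law P X" "skorokhod_nbhd A 1"] by linarith+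
  then show "{\<delta>. 0 < \<delta> \<and>
     (\<forall>A\<in>sets skorokhod_borel.
        measure (path_law P X) A \<le> measure (path_law N Y) (skorokhod_nbhd A \<delta>) + \<delta> \<and>
        measure (path_law N Y) A \<le> measure (path_law P X) (skorokhod_nbhd A \<delta>) + \<delta>)} \<noteq> {}"
    by (auto intro!: exI[of _ 1])
qed (use far in \<open>force simp: not_le[symmetric]\<close>)

section \<open>The interpolated path as a function of the iterates\<close>

text \<open>The averaged path as a function of the whole sequence of iterates. Separating it from the
  randomness reduces the measurability of the path to continuity in finitely many coordinates.\<close>

definition interp_path :: "nat \<Rightarrow> (nat \<Rightarrow> real) \<Rightarrow> real \<Rightarrow> real" where
  "interp_path T x = (\<lambda>u\<in>{0..1}.
     let n = nat \<lfloor>u * real T\<rfloor> in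
     ((\<Sum>t=1..n. x (t + 1)) + (u * real T - real n) * x (n + 2)) / sqrt (real T))"

lemma avg_path_eq_interp_path: "avg_path \<eta> M T \<omega> = interp_path T (\<lambda>t. iterate \<eta> M t \<omega>)"
  unfolding avg_path_def interp_path_def ..

text \<open>The slope of the interpolated path on a cell is \<open>sqrt T\<close> times one iterate, so the path is Lipschitz
  wherever the iterates are bounded. Only the iterates with index beyond the starting time enter.\<close>

lemma interp_path_lipschitz:
  assumes T: "0 < T" and M: "\<And>t. m + 2 \<le> t \<Longrightarrow> t \<le> T + 2 \<Longrightarrow> \<bar>x t\<bar> \<le> M"
    and u: "0 \<le> u" "u \<le> v" "v \<le> 1" "real m \<le> u * real T"
  shows "\<bar>interp_path T x v - interp_path T x u\<bar> \<le> sqrt (real T) * M * (v - u)"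
proof -
  define y z where "y = u * real T" and "z = v * real T"
  define F where "F y = (\<Sum>t=1..nat \<lfloor>y\<rfloor>. x (t + 1)) + (y - real (nat \<lfloor>y\<rfloor>)) * x (nat \<lfloor>y\<rfloor> + 2)" for y
  have yz: "real m \<le> y" "y \<le> z" "z \<le> real T"
    using u T by (auto simp: y_def z_def mult_right_mono mult_left_le_one_le)
  define k n where "k = nat \<lfloor>y\<rfloor>" and "n = nat \<lfloor>z\<rfloor>"
  have k: "real k \<le> y" "y < real k + 1" and n: "real n \<le> z" "z < real n + 1"
    using yz by (auto simp: k_def n_def)
  have mkn: "m \<le> k" "k \<le> n" "n \<le> T"
    using k n yz by linarith+
  have Fb: "\<bar>F z - F y\<bar> \<le> M * (z - y)"
  proof (cases "k = n")
    case True
    then have "F z - F y = (z - y) * x (n + 2)"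
      by (simp add: F_def k_def[symmetric] n_def[symmetric] algebra_simps)
    moreover have "\<bar>x (n + 2)\<bar> \<le> M" using M mkn True by simp
    ultimately show ?thesis
      using mult_right_mono[of "\<bar>x (n + 2)\<bar>" M "z - y"] yz by (simp add: abs_mult mult.commute)
  next
    case False
    then have kn: "k < n" using mkn by simp
    have "(\<Sum>t=1..n. x (t + 1)) = (\<Sum>t=1..k. x (t + 1)) + (\<Sum>t=k+1..n. x (t + 1))"
      using sum.ub_add_nat[of 1 k "\<lambda>t. x (t + 1)" "n - k"] kn by simp
    also have "(\<Sum>t=k+1..n. x (t + 1)) = x (k + 2) + (\<Sum>t=k+2..n. x (t + 1))"
      using sum.atLeast_Suc_atMost[of "k+1" n "\<lambda>t. x (t + 1)"] kn by simp
    finally have eq: "F z - F y = (real k + 1 - y) * x (k + 2) + (\<Sum>t=k+2..n. x (t + 1))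
        + (z - real n) * x (n + 2)"
      by (simp add: F_def k_def[symmetric] n_def[symmetric] algebra_simps)
    have "\<bar>(real k + 1 - y) * x (k + 2)\<bar> \<le> (real k + 1 - y) * M"
      using k M[of "k + 2"] mkn by (simp add: abs_mult mult_left_mono)
    moreover have "\<bar>(z - real n) * x (n + 2)\<bar> \<le> (z - real n) * M"
      using n M[of "n + 2"] mkn by (simp add: abs_mult mult_left_mono)
    moreover have "\<bar>\<Sum>t=k+2..n. x (t + 1)\<bar> \<le> (\<Sum>t=k+2..n. M)"
      using mkn by (intro order.trans[OF sum_abs] sum_mono M) auto
    moreover have "(\<Sum>t=k+2..n. M) = (real n - real k - 1) * M"
      using kn by (simp add: of_nat_diff algebra_simps)
    moreover have "(real k + 1 - y) * M + (real n - real k - 1) * M + (z - real n) * M = M * (z - y)"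
      by (simp add: algebra_simps)
    ultimately show ?thesis
      unfolding eq by linarith
  qed
  have "interp_path T x v - interp_path T x u = (F z - F y) / sqrt (real T)"
    using u by (simp add: interp_path_def F_def y_def z_def Let_def diff_divide_distrib)
  also have "\<bar>\<dots>\<bar> \<le> M * (z - y) / sqrt (real T)"
    using Fb by (simp add: abs_divide divide_right_mono)
  also have "\<dots> = sqrt (real T) * M * (v - u)"
  proof -
    have "z - y = sqrt (real T) * sqrt (real T) * (v - u)"
      by (simp add: y_def z_def algebra_simps)
    then have "M * (z - y) = sqrt (real T) * M * (v - u) * sqrt (real T)"
      by (simp only: ac_simps)
    moreover have "sqrt (real T) \<noteq> 0" using T by simp
    ultimately show ?thesis
      by (simp only: nonzero_mult_div_cancel_right not_False_eq_True)
  qed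
  finally show ?thesis .
qed

lemma interp_path_in_skorokhod_space:
  assumes "0 < T"
  shows "interp_path T x \<in> skorokhod_space"
proof (rule continuous_path_in_skorokhod_space)
  define M where "M = (\<Sum>t\<le>T + 2. \<bar>x t\<bar>)"
  have M: "\<bar>x t\<bar> \<le> M" if "t \<le> T + 2" for t
    unfolding M_def using that by (intro member_le_sum[of t _ "\<lambda>t. \<bar>x t\<bar>"]) auto
  have M0: "0 \<le> M" unfolding M_def by (rule sum_nonneg) auto
  have lip: "\<bar>interp_path T x v - interp_path T x u\<bar> \<le> sqrt (real T) * M * \<bar>v - u\<bar>"
    if "u \<in> {0..1}" "v \<in> {0..1}" for u v
  proof (cases "u \<le> v")
    case True
    then show ?thesis
      using interp_path_lipschitz[OF assms, of 0 x M u v] M that by simp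
  next
    case False
    then show ?thesis
      using interp_path_lipschitz[OF assms, of 0 x M v u] M that by (simp add: abs_minus_commute)
  qed
  have "(sqrt (real T) * M)-lipschitz_on {0..1} (interp_path T x)"
    using lip M0 by (intro lipschitz_onI) (auto simp: dist_real_def)
  then show "continuous_on {0..1} (interp_path T x)"
    by (rule lipschitz_on_continuous_on)
qed (simp add: interp_path_def)

lemma interp_path_diff:
  assumes "u \<in> {0..1}"
  shows "interp_path T x u - interp_path T y u = interp_path T (\<lambda>t. x t - y t) u"
proof -
  define n where "n = nat \<lfloor>u * real T\<rfloor>"
  have eq: "interp_path T z u = ((\<Sum>t=1..n. z (t + 1)) + (u * real T - real n) * z (n + 2)) / sqrt (real T)" for z
    unfolding interp_path_def n_def using assms by (simp only: restrict_apply if_True Let_def)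
  show ?thesis
    unfolding eq diff_divide_distrib[symmetric] sum_subtractf right_diff_distrib by simp
qed

text \<open>The path depends continuously, for the uniform distance and hence for the Skorokhod distance, on
  finitely many coordinates of the sequence, so preimages of Skorokhod-open sets are open in the
  product topology.\<close>

lemma interp_path_measurable:
  assumes T: "0 < T"
  shows "interp_path T \<in> borel \<rightarrow>\<^sub>M skorokhod_borel"
proof -
  let ?G = "{U. U \<subseteq> skorokhod_space \<and>
         (\<forall>f\<in>U. \<exists>r>0. \<forall>h\<in>skorokhod_space. skorokhod_dist f h < ereal r \<longrightarrow> h \<in> U)}"
  show ?thesis
    unfolding skorokhod_borel_def
  proof (rule measurable_measure_of)
    fix U assume U: "U \<in> ?G"
    have "open (interp_path T -` U)"
    proof (subst open_subopen, intro ballI)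
      fix x assume "x \<in> interp_path T -` U"
      then obtain r where r: "0 < r"
        and rU: "\<And>h. h \<in> skorokhod_space \<Longrightarrow> skorokhod_dist (interp_path T x) h < ereal r \<Longrightarrow> h \<in> U"
        using U by auto
      define D where "D y = (\<Sum>t\<le>T + 2. \<bar>x t - y t\<bar>)" for y :: "nat \<Rightarrow> real"
      define V where "V = {y. sqrt (real T) * D y < r}"
      have "continuous_on UNIV (\<lambda>y. sqrt (real T) * D y)"
        unfolding D_def by (intro continuous_intros continuous_on_product_coordinates)
      then have "open V"
        unfolding V_def by (intro open_Collect_less) auto
      moreover have "x \<in> V"
        using r by (simp add: V_def D_def)
      moreover have "V \<subseteq> interp_path T -` U"
      proof
        fix y assume y: "y \<in> V"
        have D0: "0 \<le> D y" unfolding D_def by (rule sum_nonneg) auto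
        have "\<bar>x t - y t\<bar> \<le> D y" if "t \<le> T + 2" for t
          unfolding D_def using that by (intro member_le_sum[of t _ "\<lambda>t. \<bar>x t - y t\<bar>"]) auto
        then have "\<bar>interp_path T (\<lambda>t. x t - y t) u - interp_path T (\<lambda>t. x t - y t) 0\<bar>
            \<le> sqrt (real T) * D y * (u - 0)" if "u \<in> {0..1}" for u
          using that by (intro interp_path_lipschitz[OF T, of 0]) auto
        moreover have "interp_path T (\<lambda>t. x t - y t) 0 = 0"
          by (simp add: interp_path_def)
        moreover have "sqrt (real T) * D y * u \<le> sqrt (real T) * D y" if "u \<in> {0..1}" for u
          using that D0 by (intro mult_left_le) auto
        ultimately have "\<bar>interp_path T x u - interp_path T y u\<bar> \<le> sqrt (real T) * D y" if "u \<in> {0..1}" for u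
          using that by (subst interp_path_diff) (auto intro: order.trans)
        then have "skorokhod_dist (interp_path T x) (interp_path T y) \<le> ereal (sqrt (real T) * D y)"
          using D0 by (intro skorokhod_dist_le_uniform) auto
        also have "\<dots> < ereal r" using y by (simp add: V_def)
        finally show "y \<in> interp_path T -` U"
          using rU interp_path_in_skorokhod_space[OF T] by simp
      qed
      ultimately show "\<exists>V. open V \<and> x \<in> V \<and> V \<subseteq> interp_path T -` U" by blast
    qed
    then show "interp_path T -` U \<inter> space borel \<in> sets borel" by simp
  qed (use interp_path_in_skorokhod_space[OF T] in auto)
qed

lemma interp_path_modulus:
  assumes T: "0 < T" and M: "\<And>t. T div 2 + 2 \<le> t \<Longrightarrow> t \<le> T + 2 \<Longrightarrow> \<bar>x t\<bar> \<le> M"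
  shows "interp_path T x \<in> modulus_set d (sqrt (real T) * M * d)"
  unfolding modulus_set_def
proof (intro CollectI conjI allI impI interp_path_in_skorokhod_space[OF T])
  fix s t assume st: "1 / 2 < s \<and> s \<le> t \<and> t \<le> 1 \<and> t - s < d"
  have M0: "0 \<le> M" using M[of "T + 2"] by simp
  have "real (T div 2) \<le> 1 / 2 * real T" by linarith
  also have "\<dots> \<le> s * real T" using st by (intro mult_right_mono) auto
  finally have "\<bar>interp_path T x t - interp_path T x s\<bar> \<le> sqrt (real T) * M * (t - s)"
    using st by (intro interp_path_lipschitz[OF T, of "T div 2"] M) auto
  also have "\<dots> \<le> sqrt (real T) * M * d"
    using st M0 by (intro mult_left_mono) auto
  finally show "\<bar>interp_path T x t - interp_path T x s\<bar> \<le> sqrt (real T) * M * d" .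
qed

section \<open>Subgaussian random variables\<close>

text \<open>The bound on the moment generating function is the only distributional information on the
  iterates that is used: it yields both the tails behind the modulus of the averaged path and the
  moments in the stability condition.\<close>

definition subgaussian :: "'a measure \<Rightarrow> real \<Rightarrow> ('a \<Rightarrow> real) \<Rightarrow> bool" where
  "subgaussian P v X \<longleftrightarrow> X \<in> borel_measurable P \<and>
     (\<forall>\<theta>. (\<integral>\<^sup>+\<omega>. ennreal (exp (\<theta> * X \<omega>)) \<partial>P) \<le> ennreal (exp (\<theta>\<^sup>2 * v / 2)))"

lemma subgaussian_mono:
  assumes "subgaussian P v X" "v \<le> w"
  shows "subgaussian P w X"
proof -
  have "ennreal (exp (\<theta>\<^sup>2 * v / 2)) \<le> ennreal (exp (\<theta>\<^sup>2 * w / 2))" for \<theta> :: real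
    using assms(2) by (intro ennreal_leI) (simp add: mult_left_mono)
  then show ?thesis
    using assms(1) unfolding subgaussian_def by (meson order.trans)
qed

text \<open>Markov's inequality for \<open>exp (\<theta> X) + exp (- \<theta> X)\<close> with the optimal \<open>\<theta> = M / v\<close>.\<close>

lemma subgaussian_tail:
  assumes X: "subgaussian P v X" and "0 < v" "prob_space P" and "0 \<le> M"
  shows "measure P {\<omega> \<in> space P. M < \<bar>X \<omega>\<bar>} \<le> 2 * exp (- M\<^sup>2 / (2 * v))"
proof -
  interpret prob_space P by fact
  have m[measurable]: "X \<in> borel_measurable P" using X by (simp add: subgaussian_def)
  have mgf: "(\<integral>\<^sup>+\<omega>. ennreal (exp (\<theta> * X \<omega>)) \<partial>P) \<le> ennreal (exp (\<theta>\<^sup>2 * v / 2))" for \<theta>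
    using X by (simp add: subgaussian_def)
  define \<theta> where "\<theta> = M / v"
  have "emeasure P {\<omega> \<in> space P. M < \<bar>X \<omega>\<bar>} = (\<integral>\<^sup>+\<omega>. indicator {\<omega> \<in> space P. M < \<bar>X \<omega>\<bar>} \<omega> \<partial>P)"
    by simp
  also have "\<dots> \<le> (\<integral>\<^sup>+\<omega>. ennreal (exp (- \<theta> * M)) *
      (ennreal (exp (\<theta> * X \<omega>)) + ennreal (exp (- \<theta> * X \<omega>))) \<partial>P)"
  proof (rule nn_integral_mono)
    fix \<omega>
    have "indicator {\<omega> \<in> space P. M < \<bar>X \<omega>\<bar>} \<omega> \<le> exp (- \<theta> * M) * (exp (\<theta> * X \<omega>) + exp (- \<theta> * X \<omega>))"
    proof (cases "M < \<bar>X \<omega>\<bar>")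
      case True
      have "\<theta> * M \<le> \<theta> * \<bar>X \<omega>\<bar>" using True assms by (intro mult_left_mono) (auto simp: \<theta>_def)
      then have "exp (\<theta> * M) \<le> exp (\<theta> * \<bar>X \<omega>\<bar>)" by simp
      also have "\<dots> \<le> exp (\<theta> * X \<omega>) + exp (- \<theta> * X \<omega>)"
        by (cases "0 \<le> X \<omega>") auto
      finally have "exp (- \<theta> * M) * exp (\<theta> * M) \<le> exp (- \<theta> * M) * (exp (\<theta> * X \<omega>) + exp (- \<theta> * X \<omega>))"
        by (intro mult_left_mono) auto
      then have "1 \<le> exp (- \<theta> * M) * (exp (\<theta> * X \<omega>) + exp (- \<theta> * X \<omega>))"
        by (simp add: exp_add[symmetric])
      then show ?thesis by (simp add: indicator_def)
    qed (simp add: indicator_def)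
    then show "indicator {\<omega> \<in> space P. M < \<bar>X \<omega>\<bar>} \<omega> \<le> ennreal (exp (- \<theta> * M)) *
      (ennreal (exp (\<theta> * X \<omega>)) + ennreal (exp (- \<theta> * X \<omega>)))"
      by (simp add: ennreal_mult''[symmetric] ennreal_plus[symmetric] ennreal_indicator[symmetric]
          del: ennreal_plus ennreal_indicator)
  qed
  also have "\<dots> = ennreal (exp (- \<theta> * M)) * ((\<integral>\<^sup>+\<omega>. ennreal (exp (\<theta> * X \<omega>)) \<partial>P)
      + (\<integral>\<^sup>+\<omega>. ennreal (exp (- \<theta> * X \<omega>)) \<partial>P))"
    by (simp add: nn_integral_cmult nn_integral_add)
  also have "\<dots> \<le> ennreal (exp (- \<theta> * M)) * (ennreal (exp (\<theta>\<^sup>2 * v / 2)) + ennreal (exp ((- \<theta>)\<^sup>2 * v / 2)))"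
    by (intro mult_left_mono add_mono mgf) auto
  also have "\<dots> = ennreal (2 * (exp (- \<theta> * M) * exp (\<theta>\<^sup>2 * v / 2)))"
    by (simp add: ennreal_mult''[symmetric] ennreal_plus[symmetric] del: ennreal_plus)
  also have "exp (- \<theta> * M) * exp (\<theta>\<^sup>2 * v / 2) = exp (- M\<^sup>2 / (2 * v))"
    using assms by (simp add: exp_add[symmetric] \<theta>_def power2_eq_square field_simps)
  finally show ?thesis
    by (simp add: emeasure_eq_measure)
qed

text \<open>For fixed \<open>r\<close> the function \<open>y powr r * exp (- y)\<close> has its maximum at \<open>y = r\<close>.\<close>

lemma powr_le_exp:
  fixes r y :: real
  assumes "0 < r" "0 \<le> y"
  shows "y powr r \<le> exp (r * ln r - r) * exp y"
proof (cases "y = 0")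
  case False
  then have y: "0 < y" using assms by simp
  have "ln (y / r) \<le> y / r - 1" using y assms by (intro ln_le_minus_one) auto
  then have "r * ln (y / r) \<le> r * (y / r - 1)" using assms by (intro mult_left_mono) auto
  then have "r * ln y \<le> r * ln r - r + y"
    using y assms by (simp add: ln_div algebra_simps)
  then show ?thesis
    using y by (simp add: powr_def exp_add[symmetric])
qed (use assms in simp)

text \<open>Powers are dominated by exponentials; applying this to \<open>X / sqrt v\<close> gives the right
  dependence on \<open>v\<close>.\<close>

lemma subgaussian_moment:
  assumes X: "subgaussian P v X" and "0 < v" "0 < r"
  shows "(\<integral>\<^sup>+\<omega>. ennreal (\<bar>X \<omega>\<bar> powr r) \<partial>P) \<le> ennreal (2 * exp (r * ln r - r + 1 / 2) * v powr (r / 2))"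
proof -
  have m[measurable]: "X \<in> borel_measurable P" using X by (simp add: subgaussian_def)
  have mgf: "(\<integral>\<^sup>+\<omega>. ennreal (exp (\<theta> * X \<omega>)) \<partial>P) \<le> ennreal (exp (\<theta>\<^sup>2 * v / 2))" for \<theta>
    using X by (simp add: subgaussian_def)
  define c where "c = exp (r * ln r - r) * v powr (r / 2)"
  define \<theta> where "\<theta> = 1 / sqrt v"
  have c0: "0 \<le> c" by (simp add: c_def)
  have \<theta>2: "\<theta>\<^sup>2 * v / 2 = 1 / 2" using assms by (simp add: \<theta>_def power_divide)
  have "(\<integral>\<^sup>+\<omega>. ennreal (\<bar>X \<omega>\<bar> powr r) \<partial>P) \<le>
    (\<integral>\<^sup>+\<omega>. ennreal c * (ennreal (exp (\<theta> * X \<omega>)) + ennreal (exp (- \<theta> * X \<omega>))) \<partial>P)"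
  proof (rule nn_integral_mono)
    fix \<omega>
    have "\<bar>X \<omega>\<bar> = sqrt v * (\<theta> * \<bar>X \<omega>\<bar>)" using assms by (simp add: \<theta>_def)
    then have "\<bar>X \<omega>\<bar> powr r = (sqrt v * (\<theta> * \<bar>X \<omega>\<bar>)) powr r"
      by (rule arg_cong[where f="\<lambda>y. y powr r"])
    also have "\<dots> = v powr (r / 2) * (\<theta> * \<bar>X \<omega>\<bar>) powr r"
      using assms by (subst powr_mult) (auto simp: \<theta>_def powr_half_sqrt[symmetric] powr_powr)
    also have "\<dots> \<le> v powr (r / 2) * (exp (r * ln r - r) * exp (\<theta> * \<bar>X \<omega>\<bar>))"
      using assms by (intro mult_left_mono powr_le_exp) (auto simp: \<theta>_def)
    also have "\<dots> = c * exp (\<theta> * \<bar>X \<omega>\<bar>)" by (simp add: c_def)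
    also have "\<dots> \<le> c * (exp (\<theta> * X \<omega>) + exp (- \<theta> * X \<omega>))"
      using c0 by (intro mult_left_mono) (cases "0 \<le> X \<omega>"; auto)+
    finally show "ennreal (\<bar>X \<omega>\<bar> powr r) \<le> ennreal c * (ennreal (exp (\<theta> * X \<omega>)) + ennreal (exp (- \<theta> * X \<omega>)))"
      using c0 by (simp add: ennreal_mult''[symmetric] ennreal_plus[symmetric] del: ennreal_plus)
  qed
  also have "\<dots> = ennreal c * ((\<integral>\<^sup>+\<omega>. ennreal (exp (\<theta> * X \<omega>)) \<partial>P)
      + (\<integral>\<^sup>+\<omega>. ennreal (exp (- \<theta> * X \<omega>)) \<partial>P))"
    by (simp add: nn_integral_cmult nn_integral_add)
  also have "\<dots> \<le> ennreal c * (ennreal (exp (\<theta>\<^sup>2 * v / 2)) + ennreal (exp ((- \<theta>)\<^sup>2 * v / 2)))"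
    by (intro mult_left_mono add_mono mgf) auto
  also have "\<dots> = ennreal (c * (exp (1 / 2) + exp (1 / 2)))"
    using c0 by (simp add: \<theta>2 ennreal_mult''[symmetric] ennreal_plus[symmetric] del: ennreal_plus)
  also have "c * (exp (1 / 2) + exp (1 / 2)) = 2 * exp (r * ln r - r + 1 / 2) * v powr (r / 2)"
    by (simp add: c_def exp_add)
  finally show ?thesis .
qed

lemma std_normal_mgf:
  assumes D: "distributed P lborel X std_normal_density"
  shows "(\<integral>\<^sup>+\<omega>. ennreal (exp (\<theta> * X \<omega>)) \<partial>P) = ennreal (exp (\<theta>\<^sup>2 / 2))"
proof -
  have "(\<integral>\<^sup>+\<omega>. ennreal (exp (\<theta> * X \<omega>)) \<partial>P) = (\<integral>\<^sup>+x. ennreal (std_normal_density x) * ennreal (exp (\<theta> * x)) \<partial>lborel)"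
    using distributed_nn_integral[OF D, of "\<lambda>x. ennreal (exp (\<theta> * x))"] by simp
  also have "\<dots> = (\<integral>\<^sup>+x. ennreal (exp (\<theta>\<^sup>2 / 2)) * ennreal (normal_density \<theta> 1 x) \<partial>lborel)"
  proof (rule nn_integral_cong)
    fix x :: real
    have "- x\<^sup>2 / 2 + \<theta> * x = \<theta>\<^sup>2 / 2 + - (x - \<theta>)\<^sup>2 / 2"
      by (simp add: power2_eq_square field_simps)
    then have "exp (- x\<^sup>2 / 2) * exp (\<theta> * x) = exp (\<theta>\<^sup>2 / 2) * exp (- (x - \<theta>)\<^sup>2 / 2)"
      by (simp only: exp_add[symmetric])
    then show "ennreal (std_normal_density x) * ennreal (exp (\<theta> * x)) = ennreal (exp (\<theta>\<^sup>2 / 2)) * ennreal (normal_density \<theta> 1 x)"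
      by (simp add: ennreal_mult''[symmetric] normal_density_def field_simps)
  qed
  also have "\<dots> = ennreal (exp (\<theta>\<^sup>2 / 2)) * (\<integral>\<^sup>+x. ennreal (normal_density \<theta> 1 x) \<partial>lborel)"
    by (simp add: nn_integral_cmult)
  also have "(\<integral>\<^sup>+x. ennreal (normal_density \<theta> 1 x) \<partial>lborel) = 1"
    by (subst nn_integral_eq_integral) auto
  finally show ?thesis by simp
qed

lemma std_normal_subgaussian:
  assumes D: "distributed P lborel X std_normal_density"
  shows "subgaussian P 1 X"
  using std_normal_mgf[OF D] distributed_measurable[OF D] by (simp add: subgaussian_def)

lemma subgaussian_weighted_sum:
  assumes "prob_space P" and I: "finite I" and ind: "prob_space.indep_vars P (\<lambda>_. borel) X I"
    and D: "\<And>i. i \<in> I \<Longrightarrow> distributed P lborel (X i) std_normal_density"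
  shows "subgaussian P (\<Sum>i\<in>I. (w i)\<^sup>2) (\<lambda>\<omega>. \<Sum>i\<in>I. w i * X i \<omega>)"
  unfolding subgaussian_def
proof (intro conjI allI)
  interpret prob_space P by fact
  have m[measurable]: "i \<in> I \<Longrightarrow> X i \<in> borel_measurable P" for i
    using distributed_measurable[OF D] by simp
  show "(\<lambda>\<omega>. \<Sum>i\<in>I. w i * X i \<omega>) \<in> borel_measurable P"
    by measurable
  fix \<theta> :: real
  have ind': "indep_vars (\<lambda>_. borel) (\<lambda>i \<omega>. ennreal (exp (\<theta> * w i * X i \<omega>))) I"
    by (rule indep_vars_compose2[OF ind, where Y="\<lambda>i x. ennreal (exp (\<theta> * w i * x))"]) measurable
  have "(\<integral>\<^sup>+\<omega>. ennreal (exp (\<theta> * (\<Sum>i\<in>I. w i * X i \<omega>))) \<partial>P)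
      = (\<integral>\<^sup>+\<omega>. (\<Prod>i\<in>I. ennreal (exp (\<theta> * w i * X i \<omega>))) \<partial>P)"
    using I by (intro nn_integral_cong)
      (simp add: prod_ennreal exp_sum[symmetric] sum_distrib_left mult.assoc)
  also have "\<dots> = (\<Prod>i\<in>I. \<integral>\<^sup>+\<omega>. ennreal (exp (\<theta> * w i * X i \<omega>)) \<partial>P)"
    by (rule indep_vars_nn_integral[OF I ind']) simp
  also have "\<dots> = (\<Prod>i\<in>I. ennreal (exp ((\<theta> * w i)\<^sup>2 / 2)))"
    by (intro prod.cong refl std_normal_mgf D)
  also have "\<dots> = ennreal (exp (\<theta>\<^sup>2 * (\<Sum>i\<in>I. (w i)\<^sup>2) / 2))"
    using I by (simp add: prod_ennreal exp_sum[symmetric] sum_distrib_left sum_divide_distrib power_mult_distrib)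
  finally show "(\<integral>\<^sup>+\<omega>. ennreal (exp (\<theta> * (\<Sum>i\<in>I. w i * X i \<omega>))) \<partial>P) \<le> ennreal (exp (\<theta>\<^sup>2 * (\<Sum>i\<in>I. (w i)\<^sup>2) / 2))"
    by simp
qed

section \<open>Conditioning on independent information\<close>

text \<open>For \<open>A\<close> in the sub-sigma-algebra, independence says that the law of \<open>X\<close> restricted to \<open>A\<close> is the
  law of \<open>X\<close> scaled by the probability of \<open>A\<close>, so the constant satisfies the defining equation of the
  conditional expectation.\<close>

lemma nn_cond_exp_indep:
  assumes "prob_space P" and F: "subalgebra P F" and X[measurable]: "X \<in> borel_measurable P"
    and ind: "\<And>A B. A \<in> sets F \<Longrightarrow> B \<in> sets borel \<Longrightarrow>
      measure P (A \<inter> (X -` B \<inter> space P)) = measure P A * measure P (X -` B \<inter> space P)"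
    and g[measurable]: "g \<in> borel_measurable borel"
  shows "AE \<omega> in P. nn_cond_exp P F (\<lambda>\<omega>. g (X \<omega>)) \<omega> = (\<integral>\<^sup>+\<omega>. g (X \<omega>) \<partial>P)"
proof -
  interpret prob_space P by fact
  interpret finite_measure_subalgebra P F by (unfold_locales, rule F)
  have "AE \<omega> in P. (\<integral>\<^sup>+\<omega>. g (X \<omega>) \<partial>P) = nn_cond_exp P F (\<lambda>\<omega>. g (X \<omega>)) \<omega>"
  proof (rule nn_cond_exp_charact)
    fix A assume A: "A \<in> sets F"
    then have AP[measurable]: "A \<in> sets P" using F by (auto simp: subalgebra_def)
    have eq: "distr (density P (indicator A)) borel X = scale_measure (emeasure P A) (distr P borel X)"
    proof (rule measure_eqI)
      fix B assume "B \<in> sets (distr (density P (indicator A)) borel X)"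
      then have B[measurable]: "B \<in> sets borel" by simp
      have "emeasure (distr (density P (indicator A)) borel X) B = emeasure P (A \<inter> (X -` B \<inter> space P))"
        by (simp add: emeasure_distr emeasure_density indicator_inter_arith[symmetric] Int_assoc)
      also have "\<dots> = emeasure P A * emeasure P (X -` B \<inter> space P)"
        using ind[OF A B] by (simp add: emeasure_eq_measure ennreal_mult'')
      finally show "emeasure (distr (density P (indicator A)) borel X) B = emeasure (scale_measure (emeasure P A) (distr P borel X)) B"
        by (simp add: emeasure_distr)
    qed simp
    have "(\<integral>\<^sup>+\<omega>\<in>A. g (X \<omega>) \<partial>P) = (\<integral>\<^sup>+\<omega>. g (X \<omega>) \<partial>density P (indicator A))"
      by (simp add: nn_integral_density mult.commute)
    also have "\<dots> = (\<integral>\<^sup>+x. g x \<partial>distr (density P (indicator A)) borel X)"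
      by (simp add: nn_integral_distr)
    also have "\<dots> = emeasure P A * (\<integral>\<^sup>+\<omega>. g (X \<omega>) \<partial>P)"
      by (simp add: eq nn_integral_scale_measure nn_integral_distr)
    also have "\<dots> = (\<integral>\<^sup>+\<omega>\<in>A. (\<integral>\<^sup>+\<omega>. g (X \<omega>) \<partial>P) \<partial>P)"
      by (subst nn_integral_cmult_indicator) (simp_all add: mult.commute)
    finally show "(\<integral>\<^sup>+\<omega>\<in>A. g (X \<omega>) \<partial>P) = (\<integral>\<^sup>+\<omega>\<in>A. (\<integral>\<^sup>+\<omega>. g (X \<omega>) \<partial>P) \<partial>P)" .
  qed auto
  then show ?thesis by (simp add: eq_commute)
qed

lemma real_cond_exp_indep:
  fixes g :: "real \<Rightarrow> real"
  assumes P: "prob_space P" and F: "subalgebra P F" and X[measurable]: "X \<in> borel_measurable P"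
    and ind: "\<And>A B. A \<in> sets F \<Longrightarrow> B \<in> sets borel \<Longrightarrow>
      measure P (A \<inter> (X -` B \<inter> space P)) = measure P A * measure P (X -` B \<inter> space P)"
    and g[measurable]: "g \<in> borel_measurable borel" and int: "integrable P (\<lambda>\<omega>. g (X \<omega>))"
  shows "AE \<omega> in P. real_cond_exp P F (\<lambda>\<omega>. g (X \<omega>)) \<omega> = (\<integral>\<omega>. g (X \<omega>) \<partial>P)"
proof -
  have "AE \<omega> in P. nn_cond_exp P F (\<lambda>\<omega>. ennreal (g (X \<omega>))) \<omega> = (\<integral>\<^sup>+\<omega>. ennreal (g (X \<omega>)) \<partial>P)"
    by (rule nn_cond_exp_indep[OF P F X ind]) auto
  moreover have "AE \<omega> in P. nn_cond_exp P F (\<lambda>\<omega>. ennreal (- g (X \<omega>))) \<omega> = (\<integral>\<^sup>+\<omega>. ennreal (- g (X \<omega>)) \<partial>P)"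
    by (rule nn_cond_exp_indep[OF P F X ind, of "\<lambda>x. ennreal (- g x)"]) auto
  ultimately show ?thesis
    by eventually_elim (simp add: real_cond_exp_def real_lebesgue_integral_def[OF int])
qed

lemma space_natural_filtration [simp]: "space (natural_filtration P X t) = space P"
  by (simp add: natural_filtration_def space_measure_of_conv)

lemma sets_natural_filtration:
  "sets (natural_filtration P X t) = sigma_sets (space P) {X s -` B \<inter> space P | s B. s \<in> {1..t} \<and> B \<in> sets borel}"
  unfolding natural_filtration_def by (rule sets_measure_of) auto

lemma natural_filtration_subalgebra:
  assumes "\<And>t. 1 \<le> t \<Longrightarrow> X t \<in> borel_measurable P"
  shows "subalgebra P (natural_filtration P X t)"
  unfolding subalgebra_def
proof
  show "sets (natural_filtration P X t) \<subseteq> sets P"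
    unfolding sets_natural_filtration
    by (rule sets.sigma_sets_subset) (use assms in \<open>auto intro: measurable_sets\<close>)
qed simp

lemma natural_filtration_adapted:
  assumes "1 \<le> t"
  shows "X t \<in> borel_measurable (natural_filtration P X t)"
proof (rule measurableI)
  fix B :: "real set" assume "B \<in> sets borel"
  then show "X t -` B \<inter> space (natural_filtration P X t) \<in> sets (natural_filtration P X t)"
    using assms unfolding sets_natural_filtration by (intro sigma_sets.Basic) auto
qed simp

lemma natural_filtration_filtration: "filtration (space P) (natural_filtration P X)"
proof
  fix i j :: nat assume "i \<le> j"
  then show "sets (natural_filtration P X i) \<subseteq> sets (natural_filtration P X j)"
    unfolding sets_natural_filtration by (intro sigma_sets_mono') (auto, metis order.trans)
qed simp

text \<open>The sigma-algebras generated by the disjoint index sets \<open>{1..t - 1}\<close> and \<open>{t}\<close> are independent.\<close>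

lemma natural_filtration_indep:
  assumes "prob_space P" and ind: "prob_space.indep_vars P (\<lambda>_. borel) X {1..}" and t: "1 \<le> t"
    and A: "A \<in> sets (natural_filtration P X (t - 1))" and B: "B \<in> sets borel"
  shows "measure P (A \<inter> (X t -` B \<inter> space P)) = measure P A * measure P (X t -` B \<inter> space P)"
proof -
  interpret prob_space P by fact
  define E where "E i = {X i -` A \<inter> space P | A. A \<in> sets borel}" for i
  define I where "I = case_bool {1..t - 1} {t}"
  have "indep_sets (\<lambda>b. sigma_sets (space P) (\<Union>i\<in>I b. E i)) UNIV"
  proof (rule indep_sets_collect_sigma)
    have "indep_sets E {1..}" using ind by (simp add: indep_vars_def2 E_def[abs_def])
    then show "indep_sets E (\<Union>b\<in>UNIV. I b)"
      by (rule indep_sets_mono_index[rotated]) (use t in \<open>auto simp: I_def split: bool.splits\<close>)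
    show "Int_stable (E i)" for i
      unfolding E_def Int_stable_def
      by (auto, metis sets.Int vimage_Int inf_assoc inf_commute inf_left_idem)
    show "disjoint_family_on I UNIV"
      using t by (auto simp: disjoint_family_on_def I_def split: bool.splits)
  qed
  moreover have "(\<lambda>b. sigma_sets (space P) (\<Union>i\<in>I b. E i)) =
     case_bool (sigma_sets (space P) (\<Union>i\<in>{1..t-1}. E i)) (sigma_sets (space P) (E t))"
    by (rule ext) (simp add: I_def split: bool.split)
  ultimately have i: "indep_set (sigma_sets (space P) (\<Union>i\<in>{1..t-1}. E i)) (sigma_sets (space P) (E t))"
    by (simp add: indep_set_def)
  have "(\<Union>i\<in>{1..t-1}. E i) = {X s -` B \<inter> space P | s B. s \<in> {1..t-1} \<and> B \<in> sets borel}"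
    unfolding E_def by blast
  then have "A \<in> sigma_sets (space P) (\<Union>i\<in>{1..t-1}. E i)"
    using A by (simp only: sets_natural_filtration)
  moreover have "X t -` B \<inter> space P \<in> sigma_sets (space P) (E t)"
    using B by (intro sigma_sets.Basic) (auto simp: E_def)
  ultimately show ?thesis
    using indep_setD[OF i] by blast
qed

section \<open>Iterates of the linear recursion\<close>

text \<open>The influence of the noise of step \<open>s\<close> on the iterate of index \<open>t\<close>: it enters with factor
  \<open>a s\<close> and is multiplied by \<open>1 - a j\<close> in every later step.\<close>

definition noise_weight :: "(nat \<Rightarrow> real) \<Rightarrow> nat \<Rightarrow> nat \<Rightarrow> real" where
  "noise_weight a t s = a s * (\<Prod>j\<in>{s<..<t}. 1 - a j)"

definition iterate_variance :: "(nat \<Rightarrow> real) \<Rightarrow> nat \<Rightarrow> real" where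
  "iterate_variance a t = (\<Sum>s\<in>{1..<t}. (noise_weight a t s)\<^sup>2)"

lemma noise_weight_Suc: "s < t \<Longrightarrow> noise_weight a (Suc t) s = (1 - a t) * noise_weight a t s"
  and noise_weight_last: "noise_weight a (Suc t) t = a t"
proof -
  assume "s < t"
  then have "{s<..<Suc t} = insert t {s<..<t}" by auto
  then show "noise_weight a (Suc t) s = (1 - a t) * noise_weight a t s"
    by (simp add: noise_weight_def)
next
  have "{t<..<Suc t} = {}" by auto
  then show "noise_weight a (Suc t) t = a t" by (simp add: noise_weight_def)
qed

lemma iterate_linear_oracle:
  "iterate a (linear_oracle P \<epsilon>) t \<omega> = (\<Sum>s\<in>{1..<t}. noise_weight a t s * \<epsilon> s \<omega>)"
proof (induction a "linear_oracle P \<epsilon>" t \<omega> rule: iterate.induct)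
  case (3 a n \<omega>)
  have "(\<Sum>s\<in>{1..<Suc (Suc n)}. noise_weight a (Suc (Suc n)) s * \<epsilon> s \<omega>)
      = (\<Sum>s\<in>{1..<Suc n}. noise_weight a (Suc (Suc n)) s * \<epsilon> s \<omega>) + a (Suc n) * \<epsilon> (Suc n) \<omega>"
    by (simp add: noise_weight_last)
  also have "(\<Sum>s\<in>{1..<Suc n}. noise_weight a (Suc (Suc n)) s * \<epsilon> s \<omega>)
      = (1 - a (Suc n)) * (\<Sum>s\<in>{1..<Suc n}. noise_weight a (Suc n) s * \<epsilon> s \<omega>)"
    unfolding sum_distrib_left by (intro sum.cong) (auto simp: noise_weight_Suc)
  finally show ?case
    using 3 by (simp add: linear_oracle_def algebra_simps)
qed auto

lemma iterate_variance_Suc: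
  assumes "1 \<le> t"
  shows "iterate_variance a (Suc t) = (1 - a t)\<^sup>2 * iterate_variance a t + (a t)\<^sup>2"
proof -
  have "iterate_variance a (Suc t) = (\<Sum>s\<in>{1..<t}. (noise_weight a (Suc t) s)\<^sup>2) + (a t)\<^sup>2"
    using assms by (simp add: iterate_variance_def noise_weight_last)
  also have "(\<Sum>s\<in>{1..<t}. (noise_weight a (Suc t) s)\<^sup>2) = (1 - a t)\<^sup>2 * iterate_variance a t"
    unfolding iterate_variance_def sum_distrib_left
    by (intro sum.cong) (auto simp: noise_weight_Suc power_mult_distrib)
  finally show ?thesis .
qed

text \<open>The variance \<open>V\<close> of the iterates satisfies \<open>V' = (1 - a)\<^sup>2 V + a\<^sup>2\<close>, whose quasi-equilibrium is of
  order \<open>a\<close>. The bound \<open>C a\<close> is preserved by the recursion as soon as the step size decreases by at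
  most \<open>a\<^sup>2 / 2\<close> per step and \<open>C \<ge> 2\<close>; since the decrease is at most \<open>a / t\<close> and \<open>\<alpha> < 1\<close>, this is true from
  some \<open>t0\<close> on. The times before \<open>t0\<close> are absorbed into \<open>C\<close>.\<close>

lemma iterate_variance_le_step:
  fixes a :: "nat \<Rightarrow> real" and \<eta> \<alpha> :: real
  assumes \<eta>: "0 < \<eta>" and \<alpha>: "0 < \<alpha>" "\<alpha> < 1" and a: "\<And>t. 1 \<le> t \<Longrightarrow> a t = \<eta> * real t powr (- \<alpha>)"
  obtains C where "0 < C" "\<And>t. 1 \<le> t \<Longrightarrow> iterate_variance a t \<le> C * a t"
proof -
  have "\<forall>\<^sub>F t in sequentially. \<eta> * real t powr (- \<alpha>) \<le> 1"
    "\<forall>\<^sub>F t in sequentially. 2 / real t \<le> \<eta> * real t powr (- \<alpha>)"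
    using \<eta> \<alpha> by real_asymp+
  then have "\<forall>\<^sub>F t in sequentially. 1 \<le> t \<and> a t \<le> 1 \<and> 2 / real t \<le> a t"
    using eventually_ge_at_top[of 1] by eventually_elim (simp add: a)
  then obtain t0 where t0: "\<And>t. t0 \<le> t \<Longrightarrow> 1 \<le> t \<and> a t \<le> 1 \<and> 2 / real t \<le> a t"
    by (auto simp: eventually_sequentially)
  have pos: "0 < a t" if "1 \<le> t" for t using that \<eta> by (simp add: a)
  define C where "C = Max (insert 2 ((\<lambda>t. iterate_variance a t / a t) ` {1..t0}))"
  have C2: "2 \<le> C" unfolding C_def by (rule Max_ge) auto
  have init: "iterate_variance a t \<le> C * a t" if "1 \<le> t" "t \<le> t0" for t
  proof -
    have "iterate_variance a t / a t \<le> C"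
      unfolding C_def by (rule Max_ge) (use that in auto)
    then show ?thesis using pos[OF that(1)] by (simp add: pos_divide_le_eq)
  qed
  have decrease: "a t - a (Suc t) \<le> a t / real t" if "1 \<le> t" for t
  proof -
    have "real t / real (Suc t) = (real t / real (Suc t)) powr 1" using that by simp
    also have "\<dots> \<le> (real t / real (Suc t)) powr \<alpha>"
      using that \<alpha> by (intro powr_mono') auto
    finally have "real t / real (Suc t) \<le> real t powr \<alpha> / real (Suc t) powr \<alpha>"
      using that by (simp add: powr_divide)
    then have "real t powr (- \<alpha>) * (real t / real (Suc t)) \<le> real t powr (- \<alpha>) * (real t powr \<alpha> / real (Suc t) powr \<alpha>)"
      by (rule mult_left_mono) simp
    also have "\<dots> = real (Suc t) powr (- \<alpha>)"
      using that by (simp add: powr_minus field_simps)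
    finally have "\<eta> * (real t powr (- \<alpha>) * (real t / real (Suc t))) \<le> \<eta> * real (Suc t) powr (- \<alpha>)"
      using \<eta> by (intro mult_left_mono) auto
    then have "a t * (real t / real (Suc t)) \<le> a (Suc t)"
      using that by (simp add: a mult.assoc)
    moreover have "real t / real (Suc t) = 1 - 1 / real (Suc t)" by (simp add: field_simps)
    ultimately have "a t * (1 - 1 / real (Suc t)) \<le> a (Suc t)"
      by (simp only:)
    then have "a t - a (Suc t) \<le> a t / real (Suc t)"
      by (simp only: right_diff_distrib mult_1_right times_divide_eq_right)
    also have "\<dots> \<le> a t / real t"
      using that pos[OF that] by (intro divide_left_mono) auto
    finally show ?thesis .
  qed
  have "iterate_variance a t \<le> C * a t" if "1 \<le> t" for t
  proof (cases "t \<le> t0")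
    case False
    then have "t0 \<le> t" by simp
    then show ?thesis
    proof (induction t rule: dec_induct)
      case base
      show ?case by (rule init) (use t0[of t0] in auto)
    next
      case (step t)
      have t: "1 \<le> t" "a t \<le> 1" "2 / real t \<le> a t" using t0 step by auto
      have "iterate_variance a (Suc t) = (1 - a t)\<^sup>2 * iterate_variance a t + (a t)\<^sup>2"
        by (rule iterate_variance_Suc[OF t(1)])
      also have "(1 - a t)\<^sup>2 * iterate_variance a t \<le> (1 - a t)\<^sup>2 * (C * a t)"
        by (rule mult_left_mono[OF step.IH]) simp
      also have "\<dots> \<le> (1 - a t) * (C * a t)"
        using t pos[OF t(1)] C2 by (intro mult_right_mono) (auto simp: power2_eq_square mult_left_le_one_le)
      finally have "iterate_variance a (Suc t) \<le> C * a t - (C - 1) * (a t)\<^sup>2"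
        by (simp add: algebra_simps power2_eq_square)
      moreover have "C * (a t - a (Suc t)) \<le> C * (a t * (a t / 2))"
      proof (rule mult_left_mono)
        have "a t - a (Suc t) \<le> a t * (1 / real t)" using decrease[OF t(1)] by simp
        also have "\<dots> \<le> a t * (a t / 2)"
          using t pos[OF t(1)] by (intro mult_left_mono) auto
        finally show "a t - a (Suc t) \<le> a t * (a t / 2)" .
      qed (use C2 in simp)
      moreover have "C / 2 * (a t)\<^sup>2 \<le> (C - 1) * (a t)\<^sup>2"
        using C2 by (intro mult_right_mono) auto
      ultimately show ?case
        by (simp add: algebra_simps power2_eq_square)
    qed
  qed (use init that in blast)
  then show thesis using that[of C] C2 by simp
qed

lemma iterate_subgaussian:
  fixes a :: "nat \<Rightarrow> real" and \<eta> \<alpha> :: real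
  assumes "0 < \<eta>" "0 < \<alpha>" "\<alpha> < 1" "\<And>t. 1 \<le> t \<Longrightarrow> a t = \<eta> * real t powr (- \<alpha>)"
    and noise: "iid_std_normal P \<epsilon>"
  obtains C where "0 < C" "\<And>t. 1 \<le> t \<Longrightarrow> subgaussian P (C * a t) (iterate a (linear_oracle P \<epsilon>) t)"
proof -
  obtain C where C: "0 < C" "\<And>t. 1 \<le> t \<Longrightarrow> iterate_variance a t \<le> C * a t"
    using iterate_variance_le_step[OF assms(1-4)] by blast
  have P: "prob_space P" and ind: "prob_space.indep_vars P (\<lambda>_. borel) \<epsilon> {1..}"
    and D: "\<And>t. 1 \<le> t \<Longrightarrow> distributed P lborel (\<epsilon> t) std_normal_density"
    using noise by (auto simp: iid_std_normal_def)
  have "subgaussian P (iterate_variance a t) (iterate a (linear_oracle P \<epsilon>) t)" for t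
    unfolding iterate_linear_oracle iterate_variance_def
    by (rule subgaussian_weighted_sum[OF P _ prob_space.indep_vars_subset[OF P ind]]) (auto intro: D)
  then show thesis
    using that[of C] C subgaussian_mono by blast
qed

text \<open>In the second half of the run all step sizes are at most \<open>2 \<eta> T powr (- \<alpha>)\<close>. With
  \<open>K = 8 C \<eta>\<close> each single tail is at most \<open>2 / T\<^sup>2\<close>, so a union bound costs only \<open>O(1 / T)\<close>.\<close>

lemma iterate_max_bound:
  fixes a :: "nat \<Rightarrow> real" and \<eta> \<alpha> :: real
  assumes \<eta>: "0 < \<eta>" and \<alpha>: "0 < \<alpha>" "\<alpha> < 1" and a: "\<And>t. 1 \<le> t \<Longrightarrow> a t = \<eta> * real t powr (- \<alpha>)"
    and noise: "iid_std_normal P \<epsilon>"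
  obtains K where "0 < K"
    "\<And>T. 16 \<le> T \<Longrightarrow> 3 / 4 \<le> measure P {\<omega> \<in> space P. \<forall>t\<in>{T div 2 + 2..T + 2}.
        \<bar>iterate a (linear_oracle P \<epsilon>) t \<omega>\<bar> \<le> sqrt (K * real T powr (- \<alpha>) * ln (real T))}"
proof -
  obtain C where C: "0 < C"
    and sub: "\<And>t. 1 \<le> t \<Longrightarrow> subgaussian P (C * a t) (iterate a (linear_oracle P \<epsilon>) t)"
    using iterate_subgaussian[OF assms] by blast
  interpret prob_space P using noise by (simp add: iid_std_normal_def)
  define K where "K = 8 * C * \<eta>"
  let ?x = "iterate a (linear_oracle P \<epsilon>)"
  have bound: "3 / 4 \<le> prob {\<omega> \<in> space P. \<forall>t\<in>{T div 2 + 2..T + 2}. \<bar>?x t \<omega>\<bar> \<le> sqrt (K * real T powr (- \<alpha>) * ln (real T))}"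
    if T: "16 \<le> T" for T
  proof -
    define M where "M = sqrt (K * real T powr (- \<alpha>) * ln (real T))"
    define v where "v = 2 * C * \<eta> * real T powr (- \<alpha>)"
    have v: "0 < v" using C \<eta> T by (simp add: v_def)
    have lnT: "0 \<le> ln (real T)" using T by simp
    have M0: "0 \<le> M" and M2: "M\<^sup>2 = K * real T powr (- \<alpha>) * ln (real T)"
      using C \<eta> lnT by (auto simp: M_def K_def)
    have expo: "- M\<^sup>2 / (2 * v) = - 2 * ln (real T)"
      using C \<eta> T by (simp add: M2 v_def K_def)
    have tail: "prob {\<omega> \<in> space P. M < \<bar>?x t \<omega>\<bar>} \<le> 2 / (real T)\<^sup>2" if t: "t \<in> {T div 2 + 2..T + 2}" for t
    proof -
      have "T \<le> 2 * t" using t by auto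
      then have "real T / 2 \<le> real t" by linarith
      then have "real t powr (- \<alpha>) \<le> (real T / 2) powr (- \<alpha>)"
        using T \<alpha> by (intro powr_mono2') auto
      also have "\<dots> = 2 powr \<alpha> * real T powr (- \<alpha>)"
        using T by (simp add: powr_divide powr_minus field_simps)
      also have "\<dots> \<le> 2 powr 1 * real T powr (- \<alpha>)"
        using \<alpha> by (intro mult_right_mono powr_mono) auto
      finally have "a t \<le> \<eta> * (2 * real T powr (- \<alpha>))"
        using \<eta> t by (subst a) auto
      then have "C * a t \<le> C * (\<eta> * (2 * real T powr (- \<alpha>)))"
        using C by (intro mult_left_mono) auto
      then have "subgaussian P v (?x t)"
        using t by (intro subgaussian_mono[OF sub]) (auto simp: v_def ac_simps)
      then have "prob {\<omega> \<in> space P. M < \<bar>?x t \<omega>\<bar>} \<le> 2 * exp (- M\<^sup>2 / (2 * v))"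
        by (rule subgaussian_tail[OF _ v prob_space_axioms M0])
      also have "exp (- M\<^sup>2 / (2 * v)) = 1 / (real T)\<^sup>2"
        using T unfolding expo by (simp add: exp_minus exp_of_nat_mult[of 2, simplified] field_simps)
      finally show ?thesis by simp
    qed
    have m[measurable]: "1 \<le> t \<Longrightarrow> ?x t \<in> borel_measurable P" for t
      using sub[of t] by (simp add: subgaussian_def)
    have ev: "{\<omega> \<in> space P. M < \<bar>?x t \<omega>\<bar>} \<in> events" if "t \<in> {T div 2 + 2..T + 2}" for t
      using m[of t] that by simp
    have "prob (\<Union>t\<in>{T div 2 + 2..T + 2}. {\<omega> \<in> space P. M < \<bar>?x t \<omega>\<bar>})
        \<le> (\<Sum>t\<in>{T div 2 + 2..T + 2}. prob {\<omega> \<in> space P. M < \<bar>?x t \<omega>\<bar>})"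
      using ev by (intro finite_measure_subadditive_finite) auto
    also have "\<dots> \<le> (\<Sum>t\<in>{T div 2 + 2..T + 2}. 2 / (real T)\<^sup>2)"
      by (rule sum_mono) (rule tail)
    also have "\<dots> \<le> real T * (2 / (real T)\<^sup>2)"
      using T unfolding sum_constant by (intro mult_right_mono) auto
    also have "\<dots> \<le> 1 / 4"
      using T by (simp add: power2_eq_square field_simps)
    finally have "prob (\<Union>t\<in>{T div 2 + 2..T + 2}. {\<omega> \<in> space P. M < \<bar>?x t \<omega>\<bar>}) \<le> 1 / 4" .
    moreover have "{\<omega> \<in> space P. \<forall>t\<in>{T div 2 + 2..T + 2}. \<bar>?x t \<omega>\<bar> \<le> M}
       = space P - (\<Union>t\<in>{T div 2 + 2..T + 2}. {\<omega> \<in> space P. M < \<bar>?x t \<omega>\<bar>})"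
      by auto
    moreover have "(\<Union>t\<in>{T div 2 + 2..T + 2}. {\<omega> \<in> space P. M < \<bar>?x t \<omega>\<bar>}) \<in> events"
      using ev by blast
    ultimately have "3 / 4 \<le> prob {\<omega> \<in> space P. \<forall>t\<in>{T div 2 + 2..T + 2}. \<bar>?x t \<omega>\<bar> \<le> M}"
      by (simp add: prob_compl)
    then show ?thesis by (simp only: M_def)
  qed
  show thesis
    by (rule that[OF _ bound]) (use C \<eta> in \<open>simp add: K_def\<close>)
qed

section \<open>Increments of Brownian motion on a grid\<close>

text \<open>The mass outside \<open>[- z, z]\<close> is at least the minimum of the density over the unit interval
  \<open>(z, z + 1]\<close>; the form \<open>exp (- 3 - z\<^sup>2)\<close> uses \<open>(z + 1)\<^sup>2 \<le> 2 z\<^sup>2 + 2\<close> and \<open>sqrt (2 pi) \<le> exp 2\<close>.\<close>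

lemma std_normal_two_sided_le:
  assumes "prob_space N" and D: "distributed N lborel Z std_normal_density" and z: "0 \<le> z"
  shows "measure N {\<omega> \<in> space N. \<bar>Z \<omega>\<bar> \<le> z} \<le> 1 - exp (- 3 - z\<^sup>2)"
proof -
  interpret prob_space N by fact
  have Z[measurable]: "Z \<in> borel_measurable N" using distributed_measurable[OF D] by simp
  have low: "exp (- 3 - z\<^sup>2) \<le> std_normal_density x" if x: "x \<in> {z<..z + 1}" for x
  proof -
    have "x\<^sup>2 \<le> (z + 1)\<^sup>2" using x z by (intro power_mono) auto
    also have "\<dots> \<le> 2 * z\<^sup>2 + 2"
      using sum_squares_ge_zero[of "z - 1" 0] by (simp add: power2_eq_square algebra_simps)
    finally have e: "exp (- z\<^sup>2 - 1) \<le> exp (- x\<^sup>2 / 2)" by simp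
    have e4: "2 * pi \<le> (exp 1 ^ 2)\<^sup>2"
    proof -
      have "(2::real) \<le> exp 1" using exp_ge_add_one_self[of 1] by simp
      then have "(2::real) ^ 4 \<le> exp 1 ^ 4" by (intro power_mono) auto
      then show ?thesis using pi_less_4 by (simp flip: power_mult)
    qed
    then have "sqrt (2 * pi) \<le> exp 1 ^ 2"
      using real_sqrt_le_mono[OF e4] by (simp only: real_sqrt_abs abs_power2)
    then have "sqrt (2 * pi) \<le> exp 2"
      by (simp add: exp_of_nat_mult[of 2 1, simplified])
    then have "exp (- 2) \<le> 1 / sqrt (2 * pi)"
      by (simp add: exp_minus field_simps)
    then have "exp (- 2) * exp (- z\<^sup>2 - 1) \<le> 1 / sqrt (2 * pi) * exp (- x\<^sup>2 / 2)"
      using e by (intro mult_mono) auto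
    then show ?thesis by (simp add: exp_add[symmetric] std_normal_density_def)
  qed
  have "ennreal (exp (- 3 - z\<^sup>2)) = (\<integral>\<^sup>+x. ennreal (exp (- 3 - z\<^sup>2)) * indicator {z<..z + 1} x \<partial>lborel)"
    by (subst nn_integral_cmult_indicator) auto
  also have "\<dots> \<le> (\<integral>\<^sup>+x. ennreal (std_normal_density x) * indicator {z<..z + 1} x \<partial>lborel)"
    using low by (intro nn_integral_mono) (auto simp: indicator_def intro!: ennreal_leI)
  also have "\<dots> = emeasure N (Z -` {z<..z + 1} \<inter> space N)"
    by (rule distributed_emeasure[OF D, symmetric]) simp
  also have "\<dots> \<le> emeasure N {\<omega> \<in> space N. \<not> \<bar>Z \<omega>\<bar> \<le> z}"
    using z by (intro emeasure_mono) auto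
  finally have "exp (- 3 - z\<^sup>2) \<le> prob {\<omega> \<in> space N. \<not> \<bar>Z \<omega>\<bar> \<le> z}"
    by (simp add: emeasure_eq_measure)
  then show ?thesis
    by (subst (asm) prob_neg) auto
qed

text \<open>The increments over the cells of a grid are independent, so it is unlikely that all of them stay
  below a multiple of their standard deviation that is small compared with the square root of the
  logarithm of their number.\<close>

lemma brownian_grid_increments_small:
  fixes W :: "real \<Rightarrow> 'b \<Rightarrow> real"
  assumes W: "brownian_motion N W" and h: "0 < h" and t0: "0 \<le> t0" and n: "0 < n" "t0 + real n * h \<le> 1"
    and z: "0 \<le> z"
  defines "S \<equiv> {\<omega> \<in> space N. \<forall>k<n. \<bar>W (t0 + real (Suc k) * h) \<omega> - W (t0 + real k * h) \<omega>\<bar> \<le> z * sqrt h}"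
  shows "S \<in> sets N" and "measure N S \<le> exp (- real n * exp (- 3 - z\<^sup>2))"
proof -
  interpret prob_space N using W by (simp add: brownian_motion_def)
  define \<tau> where "\<tau> k = t0 + real k * h" for k
  define X where "X k \<omega> = W (\<tau> (Suc k)) \<omega> - W (\<tau> k) \<omega>" for k \<omega>
  have \<tau>: "\<tau> k \<in> {0..1}" if "k \<le> n" for k
  proof -
    have "real k * h \<le> real n * h" using that h by (intro mult_right_mono) auto
    moreover have "0 \<le> real k * h" using h by simp
    ultimately show ?thesis using t0 n by (simp add: \<tau>_def)
  qed
  have \<tau>_less: "\<tau> k < \<tau> (Suc k)" for k using h by (simp add: \<tau>_def algebra_simps)
  have ind: "indep_vars (\<lambda>_. borel) X {..<n}"
    using W \<tau> \<tau>_less unfolding brownian_motion_def X_def[abs_def] by blast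
  have D: "distributed N lborel (X k) (normal_density 0 (sqrt h))" if "k < n" for k
  proof -
    have "\<tau> (Suc k) - \<tau> k = h" by (simp add: \<tau>_def algebra_simps)
    then show ?thesis
      using W \<tau>[of k] \<tau>[of "Suc k"] \<tau>_less[of k] that unfolding brownian_motion_def X_def[abs_def]
      by (metis Suc_leI atLeastAtMost_iff less_imp_le_nat)
  qed
  have Xm: "X k \<in> borel_measurable N" if "k < n" for k
    using distributed_measurable[OF D[OF that]] by simp
  define B where "B = {x::real. \<bar>x\<bar> \<le> z * sqrt h}"
  have B[measurable]: "B \<in> sets borel" unfolding B_def by measurable
  have S: "S = (\<Inter>k\<in>{..<n}. X k -` B \<inter> space N)"
    using n by (auto simp: S_def B_def X_def \<tau>_def)
  show "S \<in> sets N"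
    unfolding S using n Xm by (intro sets.finite_INT measurable_sets[OF _ B]) auto
  have single: "prob (X k -` B \<inter> space N) \<le> 1 - exp (- 3 - z\<^sup>2)" if "k < n" for k
  proof -
    have "distributed N lborel (\<lambda>\<omega>. (X k \<omega> - 0) / sqrt h) std_normal_density"
      using D[OF that] h by (subst (asm) normal_standard_normal_convert) auto
    then have "prob {\<omega> \<in> space N. \<bar>(X k \<omega> - 0) / sqrt h\<bar> \<le> z} \<le> 1 - exp (- 3 - z\<^sup>2)"
      by (rule std_normal_two_sided_le[OF prob_space_axioms _ z])
    moreover have "{\<omega> \<in> space N. \<bar>(X k \<omega> - 0) / sqrt h\<bar> \<le> z} = X k -` B \<inter> space N"
      using h by (auto simp: B_def abs_divide pos_divide_le_eq)
    ultimately show ?thesis by simp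
  qed
  have "prob S = (\<Prod>k<n. prob (X k -` B \<inter> space N))"
    unfolding S using n by (intro indep_varsD_finite[OF ind]) auto
  also have "\<dots> \<le> (\<Prod>k<n. exp (- exp (- 3 - z\<^sup>2)))"
  proof (rule prod_mono)
    fix k assume "k \<in> {..<n}"
    then have "prob (X k -` B \<inter> space N) \<le> 1 + - exp (- 3 - z\<^sup>2)" using single by simp
    also have "\<dots> \<le> exp (- exp (- 3 - z\<^sup>2))" by (rule exp_ge_add_one_self)
    finally show "0 \<le> prob (X k -` B \<inter> space N) \<and> prob (X k -` B \<inter> space N) \<le> exp (- exp (- 3 - z\<^sup>2))"
      by simp
  qed
  also have "\<dots> = exp (- real n * exp (- 3 - z\<^sup>2))"
    by (simp add: exp_of_nat_mult[symmetric])
  finally show "prob S \<le> exp (- real n * exp (- 3 - z\<^sup>2))" .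
qed

section \<open>The linear oracle and its averaged path\<close>

lemma std_normal_moments:
  assumes D: "distributed P lborel X std_normal_density"
  shows "integrable P X" "(\<integral>\<omega>. X \<omega> \<partial>P) = 0" "integrable P (\<lambda>\<omega>. (X \<omega>)\<^sup>2)" "(\<integral>\<omega>. (X \<omega>)\<^sup>2 \<partial>P) = 1"
proof -
  show "integrable P X"
    using distributed_integrable[OF D, of "\<lambda>x. x"] integrable_std_normal_moment[of 1] by simp
  show "integrable P (\<lambda>\<omega>. (X \<omega>)\<^sup>2)"
    using distributed_integrable[OF D, of "\<lambda>x. x\<^sup>2"] integrable_std_normal_moment[of 2] by simp
  show "(\<integral>\<omega>. X \<omega> \<partial>P) = 0"
    using distributed_integral[OF D, of "\<lambda>x. x"] integral_std_normal_moment_odd[of 0] by simp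
  show "(\<integral>\<omega>. (X \<omega>)\<^sup>2 \<partial>P) = 1"
    using distributed_integral[OF D, of "\<lambda>x. x\<^sup>2"] integral_std_normal_moment_even[of 1] by simp
qed

lemma linear_oracle_simps [simp]:
  "mean_field (linear_oracle P \<epsilon>) = (\<lambda>x. x)" "noise (linear_oracle P \<epsilon>) = \<epsilon>"
  "filtr (linear_oracle P \<epsilon>) = natural_filtration P \<epsilon>" "pspace (linear_oracle P \<epsilon>) = P"
  by (simp_all add: linear_oracle_def)

lemma linear_oracle_cond_A1: "cond_A1 (linear_oracle P \<epsilon>) 1"
proof -
  have "\<forall>x::real. \<bar>x\<bar> \<le> 1 \<longrightarrow> \<bar>x - 1 * x\<bar> \<le> 0 * x\<^sup>2" "\<forall>x::real. \<bar>x - 1 * x\<bar> \<le> 0" by auto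
  then show ?thesis
    unfolding cond_A1_def linear_oracle_simps using zero_less_one by blast
qed

context
  fixes P :: "'a measure" and \<epsilon> :: "nat \<Rightarrow> 'a \<Rightarrow> real"
  assumes noise: "iid_std_normal P \<epsilon>"
begin

lemma noise_facts:
  shows noise_prob_space: "prob_space P" and noise_indep: "prob_space.indep_vars P (\<lambda>_. borel) \<epsilon> {1..}"
    and noise_distributed: "1 \<le> t \<Longrightarrow> distributed P lborel (\<epsilon> t) std_normal_density"
    and noise_measurable: "1 \<le> t \<Longrightarrow> \<epsilon> t \<in> borel_measurable P"
    and noise_subalgebra: "subalgebra P (natural_filtration P \<epsilon> k)"
proof -
  show 1: "1 \<le> t \<Longrightarrow> distributed P lborel (\<epsilon> t) std_normal_density" for t
    using noise by (simp add: iid_std_normal_def)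
  show 2: "1 \<le> t \<Longrightarrow> \<epsilon> t \<in> borel_measurable P" for t
    using distributed_measurable[OF 1] by simp
  show "subalgebra P (natural_filtration P \<epsilon> k)"
    by (rule natural_filtration_subalgebra) (rule 2)
qed (use noise in \<open>auto simp: iid_std_normal_def\<close>)

lemma noise_cond_mean:
  assumes t: "1 \<le> t"
  shows "AE \<omega> in P. real_cond_exp P (natural_filtration P \<epsilon> (t - 1)) (\<epsilon> t) \<omega> = 0"
proof -
  have "AE \<omega> in P. real_cond_exp P (natural_filtration P \<epsilon> (t - 1)) (\<lambda>\<omega>. \<epsilon> t \<omega>) \<omega> = (\<integral>\<omega>. \<epsilon> t \<omega> \<partial>P)"
    by (rule real_cond_exp_indep[where g="\<lambda>x. x", OF noise_prob_space noise_subalgebra noise_measurable[OF t]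
        natural_filtration_indep[OF noise_prob_space noise_indep t]])
      (auto simp: std_normal_moments[OF noise_distributed[OF t]])
  then show ?thesis by (simp only: std_normal_moments[OF noise_distributed[OF t]])
qed

lemma noise_cond_variance:
  assumes t: "1 \<le> t"
  shows "AE \<omega> in P. real_cond_exp P (natural_filtration P \<epsilon> (t - 1)) (\<lambda>\<omega>. (\<epsilon> t \<omega>)\<^sup>2) \<omega> = 1"
proof -
  have "AE \<omega> in P. real_cond_exp P (natural_filtration P \<epsilon> (t - 1)) (\<lambda>\<omega>. (\<epsilon> t \<omega>)\<^sup>2) \<omega> = (\<integral>\<omega>. (\<epsilon> t \<omega>)\<^sup>2 \<partial>P)"
    by (rule real_cond_exp_indep[where g="\<lambda>x. x\<^sup>2", OF noise_prob_space noise_subalgebra noise_measurable[OF t]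
        natural_filtration_indep[OF noise_prob_space noise_indep t]])
      (auto simp: std_normal_moments[OF noise_distributed[OF t]])
  then show ?thesis by (simp only: std_normal_moments[OF noise_distributed[OF t]])
qed

lemma linear_oracle_is_stoch_oracle: "is_stoch_oracle (linear_oracle P \<epsilon>)"
  unfolding is_stoch_oracle_def linear_oracle_simps
proof (intro conjI allI impI)
  show "prob_space P" by (rule noise_prob_space)
  show "filtration (space P) (natural_filtration P \<epsilon>)" by (rule natural_filtration_filtration)
  show "subalgebra P (natural_filtration P \<epsilon> t)" for t by (rule noise_subalgebra)
  fix t :: nat assume t: "1 \<le> t"
  show "\<epsilon> t \<in> borel_measurable (natural_filtration P \<epsilon> t)" by (rule natural_filtration_adapted[OF t])
  show "integrable P (\<epsilon> t)" by (rule std_normal_moments(1)[OF noise_distributed[OF t]])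
  show "AE \<omega> in P. real_cond_exp P (natural_filtration P \<epsilon> (t - 1)) (\<epsilon> t) \<omega> = 0" by (rule noise_cond_mean[OF t])
qed auto

lemma linear_oracle_cond_A3:
  assumes "0 < p"
  shows "cond_A3 (linear_oracle P \<epsilon>) p"
proof -
  define Mp where "Mp = 2 * exp (p * ln p - p + 1 / 2)"
  have moment: "AE \<omega> in P. nn_cond_exp P (natural_filtration P \<epsilon> (t - 1)) (\<lambda>\<omega>'. ennreal (\<bar>\<epsilon> t \<omega>'\<bar> powr p)) \<omega> \<le> ennreal Mp"
    if t: "1 \<le> t" for t
  proof -
    have le: "(\<integral>\<^sup>+\<omega>. ennreal (\<bar>\<epsilon> t \<omega>\<bar> powr p) \<partial>P) \<le> ennreal Mp"
      using subgaussian_moment[OF std_normal_subgaussian[OF noise_distributed[OF t]] _ assms] by (simp add: Mp_def)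
    have "AE \<omega> in P. nn_cond_exp P (natural_filtration P \<epsilon> (t - 1)) (\<lambda>\<omega>'. ennreal (\<bar>\<epsilon> t \<omega>'\<bar> powr p)) \<omega>
        = (\<integral>\<^sup>+\<omega>. ennreal (\<bar>\<epsilon> t \<omega>\<bar> powr p) \<partial>P)"
      by (rule nn_cond_exp_indep[where g="\<lambda>x. ennreal (\<bar>x\<bar> powr p)",
            OF noise_prob_space noise_subalgebra noise_measurable[OF t]
        natural_filtration_indep[OF noise_prob_space noise_indep t]]) auto
    then show ?thesis by eventually_elim (use le in simp)
  qed
  have "AE \<omega> in P. \<forall>t\<ge>1. real_cond_exp P (natural_filtration P \<epsilon> (t - 1)) (\<epsilon> t) \<omega> = 0 \<and>
     nn_cond_exp P (natural_filtration P \<epsilon> (t - 1)) (\<lambda>\<omega>'. ennreal (\<bar>\<epsilon> t \<omega>'\<bar> powr p)) \<omega> \<le> ennreal Mp"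
    unfolding AE_all_countable
  proof (intro allI AE_impI)
    fix t :: nat assume t: "1 \<le> t"
    show "AE \<omega> in P. real_cond_exp P (natural_filtration P \<epsilon> (t - 1)) (\<epsilon> t) \<omega> = 0 \<and>
       nn_cond_exp P (natural_filtration P \<epsilon> (t - 1)) (\<lambda>\<omega>'. ennreal (\<bar>\<epsilon> t \<omega>'\<bar> powr p)) \<omega> \<le> ennreal Mp"
      using moment[OF t] noise_cond_mean[OF t] by eventually_elim simp
  qed
  then show ?thesis
    unfolding cond_A3_def linear_oracle_simps by blast
qed

lemma linear_oracle_cond_A4: "cond_A4 (linear_oracle P \<epsilon>) 1"
proof -
  let ?V = "\<lambda>t \<omega>. real_cond_exp P (natural_filtration P \<epsilon> (t - 1)) (\<lambda>\<omega>'. (\<epsilon> t \<omega>')\<^sup>2) \<omega>"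
  have V: "AE \<omega> in P. \<forall>t\<ge>1. ?V t \<omega> = 1"
    unfolding AE_all_countable by (intro allI AE_impI noise_cond_variance)
  have zero: "(\<integral>\<^sup>+ \<omega>. ennreal (MAX n\<in>{0..m}. \<bar>1 / real m * (\<Sum>t=1..n. ?V t \<omega>) - real n / real m * 1\<bar>) \<partial>P)
      = (\<integral>\<^sup>+ \<omega>. 0 \<partial>P)" for m
  proof (rule nn_integral_cong_AE)
    show "AE \<omega> in P. ennreal (MAX n\<in>{0..m}. \<bar>1 / real m * (\<Sum>t=1..n. ?V t \<omega>) - real n / real m * 1\<bar>) = 0"
      using V
    proof eventually_elim
      fix \<omega> assume "\<forall>t\<ge>1. ?V t \<omega> = 1"
      then have "(\<Sum>t=1..n. ?V t \<omega>) = real n" for n by (subst sum.cong[OF refl, where h="\<lambda>_. 1"]) auto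
      then show "ennreal (MAX n\<in>{0..m}. \<bar>1 / real m * (\<Sum>t=1..n. ?V t \<omega>) - real n / real m * 1\<bar>) = 0"
        by (simp add: image_constant_conv)
    qed
  qed
  show ?thesis
    unfolding cond_A4_def linear_oracle_simps zero
  proof (intro conjI allI impI exI[of _ 1])
    show "integrable P (\<lambda>\<omega>. (\<epsilon> t \<omega>)\<^sup>2)" if "1 \<le> t" for t
      by (rule std_normal_moments(3)[OF noise_distributed[OF that]])
  qed auto
qed

lemma linear_oracle_cond_A5:
  fixes \<eta> \<alpha> q :: real
  assumes "0 < \<eta>" "0 < \<alpha>" "\<alpha> < 1" and a: "\<And>t. 1 \<le> t \<Longrightarrow> a t = \<eta> * real t powr (- \<alpha>)" and q: "0 < q"
  shows "cond_A5 a (linear_oracle P \<epsilon>) q"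
proof -
  obtain C where C: "0 < C" and sub: "\<And>t. 1 \<le> t \<Longrightarrow> subgaussian P (C * a t) (iterate a (linear_oracle P \<epsilon>) t)"
    using iterate_subgaussian[OF assms(1-4) noise] by blast
  define c where "c = 2 * exp (2 * q * ln (2 * q) - 2 * q + 1 / 2)"
  have "(\<integral>\<^sup>+\<omega>. ennreal (\<bar>iterate a (linear_oracle P \<epsilon>) t \<omega>\<bar> powr (2 * q)) \<partial>P) \<le> ennreal (c * C powr q * a t powr q)"
    if t: "1 \<le> t" for t
  proof -
    have pos: "0 < a t" using a[OF t] assms t by simp
    have "(\<integral>\<^sup>+\<omega>. ennreal (\<bar>iterate a (linear_oracle P \<epsilon>) t \<omega>\<bar> powr (2 * q)) \<partial>P)
        \<le> ennreal (c * (C * a t) powr (2 * q / 2))"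
      unfolding c_def using C pos q by (intro subgaussian_moment[OF sub[OF t]]) auto
    also have "(C * a t) powr (2 * q / 2) = C powr q * a t powr q"
      using C pos by (simp add: powr_mult)
    finally show ?thesis by (simp add: mult.assoc)
  qed
  then show ?thesis
    unfolding cond_A5_def linear_oracle_simps by blast
qed

lemma avg_path_measurable:
  assumes "0 < T"
  shows "avg_path a (linear_oracle P \<epsilon>) T \<in> P \<rightarrow>\<^sub>M skorokhod_borel"
proof -
  have "(\<lambda>\<omega>. iterate a (linear_oracle P \<epsilon>) t \<omega>) \<in> borel_measurable P" for t
    unfolding iterate_linear_oracle using noise_measurable by (intro borel_measurable_sum) auto
  then have "(\<lambda>\<omega> t. iterate a (linear_oracle P \<epsilon>) t \<omega>) \<in> borel_measurable P"
    by (rule measurable_coordinatewise_then_product)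
  then have "(\<lambda>\<omega>. interp_path T (\<lambda>t. iterate a (linear_oracle P \<epsilon>) t \<omega>)) \<in> P \<rightarrow>\<^sub>M skorokhod_borel"
    by (rule measurable_compose[OF _ interp_path_measurable[OF assms]])
  then show ?thesis
    by (simp add: avg_path_eq_interp_path[abs_def])
qed

text \<open>On the event that the late iterates are bounded by \<open>M\<close>, the path is Lipschitz with constant
  \<open>sqrt T * M\<close> after time \<open>1 / 2\<close>.\<close>

lemma avg_path_modulus:
  fixes \<eta> \<alpha> :: real
  assumes "0 < \<eta>" "0 < \<alpha>" "\<alpha> < 1" "\<And>t. 1 \<le> t \<Longrightarrow> a t = \<eta> * real t powr (- \<alpha>)"
  obtains K where "0 < K"
    "\<And>T d. 16 \<le> T \<Longrightarrow> 3 / 4 \<le> measure (path_law P (avg_path a (linear_oracle P \<epsilon>) T))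
       (modulus_set d (sqrt (real T) * sqrt (K * real T powr (- \<alpha>) * ln (real T)) * d))"
proof -
  interpret prob_space P by (rule noise_prob_space)
  obtain K where K: "0 < K" and
    max: "\<And>T. 16 \<le> T \<Longrightarrow> 3 / 4 \<le> measure P {\<omega> \<in> space P. \<forall>t\<in>{T div 2 + 2..T + 2}.
        \<bar>iterate a (linear_oracle P \<epsilon>) t \<omega>\<bar> \<le> sqrt (K * real T powr (- \<alpha>) * ln (real T))}"
    using iterate_max_bound[OF assms noise] by blast
  show thesis
  proof (rule that[OF K])
    fix T :: nat and d :: real
    assume T: "16 \<le> T"
    define M where "M = sqrt (K * real T powr (- \<alpha>) * ln (real T))"
    let ?\<Phi> = "avg_path a (linear_oracle P \<epsilon>) T"
    let ?A = "modulus_set d (sqrt (real T) * M * d)"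
    have m: "?\<Phi> \<in> P \<rightarrow>\<^sub>M skorokhod_borel" using T by (intro avg_path_measurable) auto
    have "3 / 4 \<le> prob {\<omega> \<in> space P. \<forall>t\<in>{T div 2 + 2..T + 2}. \<bar>iterate a (linear_oracle P \<epsilon>) t \<omega>\<bar> \<le> M}"
      using max[OF T] by (simp only: M_def)
    also have "\<dots> \<le> prob (?\<Phi> -` ?A \<inter> space P)"
      using T by (intro finite_measure_mono measurable_sets[OF m modulus_set_measurable])
        (auto simp: avg_path_eq_interp_path intro!: interp_path_modulus)
    also have "\<dots> = measure (path_law P ?\<Phi>) ?A"
      by (rule measure_distr[OF m modulus_set_measurable, symmetric])
    finally show "3 / 4 \<le> measure (path_law P ?\<Phi>)
       (modulus_set d (sqrt (real T) * sqrt (K * real T powr (- \<alpha>) * ln (real T)) * d))"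
      by (simp only: M_def)
  qed
qed

end

section \<open>The lower bound\<close>

text \<open>The grid \<open>3 / 4 + k h\<close> lies where increments of a path are controlled by a nearby member of the
  modulus set, at the cost of \<open>2 r\<close>.\<close>

lemma brownian_path_modulus:
  fixes W :: "real \<Rightarrow> 'b \<Rightarrow> real"
  assumes W: "brownian_motion N W" and h: "0 < h" and n: "0 < n" "real n * h \<le> 1 / 4"
    and r: "0 < r" "r \<le> 1 / 3" and z: "0 \<le> z" "a + 2 * r \<le> z * sqrt h" and d: "2 * h < d"
  shows "measure (path_law N (\<lambda>\<omega>. \<lambda>t\<in>{0..1}. W t \<omega>)) (skorokhod_nbhd (modulus_set d a) r)
    \<le> exp (- real n * exp (- 3 - z\<^sup>2))"
proof -
  define \<tau> where "\<tau> k = 3 / 4 + real k * h" for k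
  have N: "prob_space N" using W by (simp add: brownian_motion_def)
  have n': "3 / 4 + real n * h \<le> 1" using n by simp
  note grid = brownian_grid_increments_small[OF W h _ n(1) n' z(1)]
  have "measure (path_law N (\<lambda>\<omega>. \<lambda>t\<in>{0..1}. W t \<omega>)) (skorokhod_nbhd (modulus_set d a) r)
    \<le> measure N {\<omega> \<in> space N. \<forall>k<n. \<bar>W (3 / 4 + real (Suc k) * h) \<omega> - W (3 / 4 + real k * h) \<omega>\<bar> \<le> z * sqrt h}"
  proof (rule measure_distr_le[OF N grid(1)])
    fix \<omega> assume nb: "(\<lambda>t\<in>{0..1}. W t \<omega>) \<in> skorokhod_nbhd (modulus_set d a) r"
    show "\<forall>k<n. \<bar>W (3 / 4 + real (Suc k) * h) \<omega> - W (3 / 4 + real k * h) \<omega>\<bar> \<le> z * sqrt h"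
    proof (intro allI impI)
      fix k assume k: "k < n"
      have "real (Suc k) * h \<le> real n * h" using k h by (intro mult_right_mono) auto
      then have le1: "3 / 4 + real (Suc k) * h \<le> 1" using n' by simp
      have k0: "0 \<le> real k * h" using h by simp
      have Suc: "real (Suc k) * h = real k * h + h" by (simp add: algebra_simps)
      have "\<bar>(\<lambda>t\<in>{0..1}. W t \<omega>) (3 / 4 + real (Suc k) * h) - (\<lambda>t\<in>{0..1}. W t \<omega>) (3 / 4 + real k * h)\<bar> \<le> a + 2 * r"
        by (rule modulus_set_nbhd[OF nb r]) (use le1 k0 h d Suc in auto)
      then show "\<bar>W (3 / 4 + real (Suc k) * h) \<omega> - W (3 / 4 + real k * h) \<omega>\<bar> \<le> z * sqrt h"
        using le1 k0 h Suc z(2) by simp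
    qed
  qed simp
  also have "\<dots> \<le> exp (- real n * exp (- 3 - z\<^sup>2))"
    by (rule grid(2)) simp
  finally show ?thesis .
qed

text \<open>At the scale \<open>h = \<kappa> T powr (\<alpha> - 1)\<close> the typical largest Brownian increment is of order
  \<open>sqrt \<kappa> * R\<close> with \<open>R = T powr (- (1 - \<alpha>) / 2) * sqrt (ln T)\<close>, while the increments of the averaged path
  are at most of order \<open>\<kappa> * R\<close>. Hence a small \<open>\<kappa>\<close> separates the two laws at distance of order \<open>R\<close>.\<close>

lemma prokhorov_dist_lower_bound:
  fixes \<eta> \<alpha> :: real and a :: "nat \<Rightarrow> real"
  assumes "0 < \<eta>" "0 < \<alpha>" and \<alpha>: "\<alpha> < 1" and a: "\<And>t. 1 \<le> t \<Longrightarrow> a t = \<eta> * real t powr (- \<alpha>)"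
    and noise: "iid_std_normal P \<epsilon>" and W: "brownian_motion N W"
  shows "\<exists>c>0. \<exists>T0::nat. \<forall>T\<ge>T0.
    prokhorov_dist (path_law P (avg_path a (linear_oracle P \<epsilon>) T)) (path_law N (\<lambda>\<omega>. \<lambda>t\<in>{0..1}. W t \<omega>))
      \<ge> c * real T powr (- ((1 - \<alpha>) / 2)) * sqrt (ln (real T))"
proof -
  obtain K where K: "0 < K"
    and mod: "\<And>T d. 16 \<le> T \<Longrightarrow> 3 / 4 \<le> measure (path_law P (avg_path a (linear_oracle P \<epsilon>) T))
       (modulus_set d (sqrt (real T) * sqrt (K * real T powr (- \<alpha>) * ln (real T)) * d))"
    using avg_path_modulus[OF noise assms(1-4)] by blast
  have P: "prob_space P" and N: "prob_space N"
    using noise W by (auto simp: iid_std_normal_def brownian_motion_def)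
  define \<beta> where "\<beta> = (1 - \<alpha>) / 2"
  have \<beta>: "0 < \<beta>" "\<alpha> = 1 - 2 * \<beta>" using \<alpha> by (simp_all add: \<beta>_def field_simps)
  \<comment> \<open>This \<open>\<kappa>\<close> makes the threshold \<open>z\<close> below satisfy \<open>z\<^sup>2 = \<beta> ln T\<close>: a single increment exceeds it with
    probability of order at least \<open>T powr (- \<beta>)\<close>, and there are of order \<open>T powr (2 * \<beta>)\<close> increments.\<close>
  define \<kappa> where "\<kappa> = \<beta> / (25 * K)"
  have \<kappa>: "0 < \<kappa>" using K \<beta> by (simp add: \<kappa>_def)
  define c where "c = \<kappa> * sqrt K"
  have c: "0 < c" using \<kappa> K by (simp add: c_def)
  have "\<forall>\<^sub>F x::real in at_top. ln 4 \<le> (x powr (2 * \<beta>) / (4 * \<kappa>) - 1) * (exp (- 3) * x powr (- \<beta>))"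
    "\<forall>\<^sub>F x::real in at_top. c * x powr (- \<beta>) * sqrt (ln x) \<le> 1 / 4"
    "\<forall>\<^sub>F x::real in at_top. 2 \<le> x powr (2 * \<beta>) / (4 * \<kappa>)"
    using \<beta>(1) \<kappa> c by real_asymp+
  then have "\<forall>\<^sub>F x::real in at_top. ln 4 \<le> (x powr (2 * \<beta>) / (4 * \<kappa>) - 1) * (exp (- 3) * x powr (- \<beta>))
    \<and> c * x powr (- \<beta>) * sqrt (ln x) \<le> 1 / 4 \<and> 2 \<le> x powr (2 * \<beta>) / (4 * \<kappa>)"
    by eventually_elim simp
  then obtain x0 where x0: "\<And>x::real. x0 \<le> x \<Longrightarrow> ln 4 \<le> (x powr (2 * \<beta>) / (4 * \<kappa>) - 1) * (exp (- 3) * x powr (- \<beta>))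
    \<and> c * x powr (- \<beta>) * sqrt (ln x) \<le> 1 / 4 \<and> 2 \<le> x powr (2 * \<beta>) / (4 * \<kappa>)"
    by (auto simp: eventually_at_top_linorder)
  have "c * real T powr (- \<beta>) * sqrt (ln (real T))
      \<le> prokhorov_dist (path_law P (avg_path a (linear_oracle P \<epsilon>) T)) (path_law N (\<lambda>\<omega>. \<lambda>t\<in>{0..1}. W t \<omega>))"
    if T0: "max 16 (nat \<lceil>x0\<rceil>) \<le> T" for T
  proof (rule prokhorov_dist_ge[OF P N])
    have T: "16 \<le> T" "x0 \<le> real T" using T0 by linarith+
    note large = x0[OF T(2)]
    define L where "L = ln (real T)"
    have L: "0 \<le> L" using T by (simp add: L_def)
    define h where "h = \<kappa> * real T powr (- (2 * \<beta>))"
    have h: "0 < h" using \<kappa> T by (simp add: h_def)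
    \<comment> \<open>\<open>z * sqrt h = 5 c R\<close> covers the modulus bound \<open>A = 3 c R\<close> and twice the distance \<open>\<delta> < c R\<close>,
      where \<open>R = T powr (- \<beta>) * sqrt L\<close>.\<close>
    define z where "z = 5 * sqrt (\<kappa> * K) * sqrt L"
    have z0: "0 \<le> z" using \<kappa> K L by (simp add: z_def)
    have z2: "z\<^sup>2 = \<beta> * L"
      using \<beta>(1) \<kappa> K L by (simp add: z_def power_mult_distrib \<kappa>_def)
    have sqrt_h: "sqrt h = sqrt \<kappa> * real T powr (- \<beta>)"
      using T by (simp add: h_def real_sqrt_mult powr_half_sqrt[symmetric] powr_powr)
    have zh: "z * sqrt h = 5 * c * real T powr (- \<beta>) * sqrt L"
      using \<kappa> by (simp add: sqrt_h z_def c_def real_sqrt_mult)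
    \<comment> \<open>The modulus set has width \<open>3 h\<close>, which exceeds twice the grid width as transport by a time
      change requires.\<close>
    define A where "A = sqrt (real T) * sqrt (K * real T powr (- \<alpha>) * ln (real T)) * (3 * h)"
    have A: "A = 3 * c * real T powr (- \<beta>) * sqrt L"
    proof -
      have "sqrt (real T) = real T powr (1 / 2)" "sqrt (real T powr (- \<alpha>)) = real T powr ((- \<alpha>) / 2)"
        by (simp_all add: powr_half_sqrt[symmetric] powr_powr)
      then have "sqrt (real T) * sqrt (real T powr (- \<alpha>)) * real T powr (- (2 * \<beta>)) = real T powr (1 / 2 + (- \<alpha>) / 2 + - (2 * \<beta>))"
        by (simp only: powr_add)
      also have "1 / 2 + (- \<alpha>) / 2 + - (2 * \<beta>) = - \<beta>" using \<beta>(2) by (simp add: field_simps)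
      finally have e: "sqrt (real T) * sqrt (real T powr (- \<alpha>)) * real T powr (- (2 * \<beta>)) = real T powr (- \<beta>)" .
      have "A = 3 * (\<kappa> * sqrt K) * (sqrt (real T) * sqrt (real T powr (- \<alpha>)) * real T powr (- (2 * \<beta>))) * sqrt L"
        by (simp add: A_def h_def real_sqrt_mult L_def)
      then show ?thesis unfolding e c_def .
    qed
    \<comment> \<open>The number of grid cells that fit into \<open>[3 / 4, 1]\<close>.\<close>
    define n where "n = nat \<lfloor>1 / (4 * h)\<rfloor>"
    have inv_h: "1 / (4 * h) = real T powr (2 * \<beta>) / (4 * \<kappa>)"
      using T \<kappa> by (simp add: h_def powr_minus field_simps)
    have n: "real n \<le> 1 / (4 * h)" "1 / (4 * h) - 1 \<le> real n"
      using h unfolding n_def by auto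
    have n0: "0 < n" using n(2) large unfolding inv_h by (cases n) auto
    have nh: "real n * h \<le> 1 / 4" using n(1) h by (simp add: field_simps)
    have "ln 4 \<le> (1 / (4 * h) - 1) * (exp (- 3) * real T powr (- \<beta>))"
      using large unfolding inv_h by simp
    also have "\<dots> \<le> real n * (exp (- 3) * real T powr (- \<beta>))"
      using n(2) by (intro mult_right_mono) auto
    also have "exp (- 3) * real T powr (- \<beta>) = exp (- 3 - z\<^sup>2)"
      using T by (simp add: z2 L_def powr_def exp_add[symmetric])
    finally have "exp (- real n * exp (- 3 - z\<^sup>2)) \<le> exp (- ln 4)" by simp
    also have "exp (- ln 4) = (1 / 4 :: real)" by (simp add: exp_minus)
    finally have small: "exp (- real n * exp (- 3 - z\<^sup>2)) \<le> 1 / 4" .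
    fix \<delta> :: real assume \<delta>: "0 < \<delta>" "\<delta> < c * real T powr (- \<beta>) * sqrt (ln (real T))"
    have \<delta>4: "\<delta> < 1 / 4" using \<delta>(2) large by linarith
    have "A + 2 * \<delta> \<le> z * sqrt h"
      unfolding A zh using \<delta>(2) by (simp add: L_def ac_simps)
    then have "measure (path_law N (\<lambda>\<omega>. \<lambda>t\<in>{0..1}. W t \<omega>)) (skorokhod_nbhd (modulus_set (3 * h) A) \<delta>) \<le> 1 / 4"
      using \<delta> \<delta>4 h small by (intro order.trans[OF brownian_path_modulus[OF W h n0 nh _ _ z0]]) auto
    moreover have "3 / 4 \<le> measure (path_law P (avg_path a (linear_oracle P \<epsilon>) T)) (modulus_set (3 * h) A)"
      unfolding A_def by (rule mod[OF T(1)])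
    ultimately show "\<exists>B\<in>sets skorokhod_borel. measure (path_law N (\<lambda>\<omega>. \<lambda>t\<in>{0..1}. W t \<omega>)) (skorokhod_nbhd B \<delta>) + \<delta>
        < measure (path_law P (avg_path a (linear_oracle P \<epsilon>) T)) B"
      using \<delta>4 by (intro bexI[OF _ modulus_set_measurable[of "3 * h" A]]) linarith
  qed
  then show ?thesis
    using c unfolding \<beta>_def by blast
qed

theorem theorem3p5:
  fixes \<eta> \<alpha> p q :: real
    and P :: "'a measure" and \<epsilon> :: "nat \<Rightarrow> 'a \<Rightarrow> real"
    and N :: "'b measure" and W :: "real \<Rightarrow> 'b \<Rightarrow> real"
    and step :: "nat \<Rightarrow> real" and Msm :: "'a stoch_oracle"
  assumes "\<eta> > 0" and "1 / 2 < \<alpha>" and "\<alpha> < 1"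
    and step_eq: "\<And>t. t \<ge> 1 \<Longrightarrow> step t = \<eta> * real t powr (- \<alpha>)"
    and noise: "iid_std_normal P \<epsilon>"
    and Msm_eq: "Msm = linear_oracle P \<epsilon>"
    and W: "brownian_motion N W"
    and "p > 2" and "1 \<le> q" and "q \<le> p / 2"
  shows "is_stoch_oracle Msm \<and>
    cond_A1 Msm 1 \<and> cond_A2 step \<eta> \<alpha> \<and> cond_A3 Msm p \<and> cond_A4 Msm 1 \<and> cond_A5 step Msm q \<and>
    (\<exists>c>0. \<exists>T0::nat. \<forall>T\<ge>T0.
       worst_case_error N W step (\<lambda>_. 1) (\<lambda>_. 1) T {Msm}
         = prokhorov_dist (path_law P (avg_path step Msm T)) (path_law N (\<lambda>\<omega>. \<lambda>t\<in>{0..1}. W t \<omega>)) \<and>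
       prokhorov_dist (path_law P (avg_path step Msm T)) (path_law N (\<lambda>\<omega>. \<lambda>t\<in>{0..1}. W t \<omega>))
         \<ge> c * real T powr (- ((1 - \<alpha>) / 2)) * sqrt (ln (real T)))"
proof -
  have "0 < \<alpha>" using assms(2) by simp
  note params = assms(1) this assms(3) step_eq
  have "target_path 1 1 W = (\<lambda>\<omega>. \<lambda>t\<in>{0..1}. W t \<omega>)"
    by (simp add: target_path_def fun_eq_iff)
  then have error: "worst_case_error N W step (\<lambda>_. 1) (\<lambda>_. 1) T {Msm}
      = prokhorov_dist (path_law P (avg_path step Msm T)) (path_law N (\<lambda>\<omega>. \<lambda>t\<in>{0..1}. W t \<omega>))" for T
    by (simp add: worst_case_error_def Msm_eq)
  have "cond_A2 step \<eta> \<alpha>"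
    using assms(1-4) by (simp add: cond_A2_def)
  moreover have "cond_A3 Msm p" "cond_A5 step Msm q"
    unfolding Msm_eq using assms(8,9)
    by (auto intro: linear_oracle_cond_A3[OF noise] linear_oracle_cond_A5[OF noise params])
  moreover note linear_oracle_is_stoch_oracle[OF noise] linear_oracle_cond_A1 linear_oracle_cond_A4[OF noise]
    prokhorov_dist_lower_bound[OF params noise W]
  ultimately show ?thesis
    unfolding error unfolding Msm_eq by simp
qed

end
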